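(* Let $\boldsymbol E\in\mathbb R^d$. Let $\boldsymbol A\in L^\infty_\#(\mathcal Y;\mathbb R^{d\times d})$ and suppose there are constants $0<c_A\le C_A<+\infty$ such that for a.e. $\boldsymbol x\in\mathcal Y$ the matrix $\boldsymbol A(\boldsymbol x)$ is symmetric and $c_A\|\boldsymbol v\|_{\mathbb R^d}^2\le(\boldsymbol A(\boldsymbol x)\boldsymbol v,\boldsymbol v)_{\mathbb R^d}\le C_A\|\boldsymbol v\|_{\mathbb R^d}^2$ for all $\boldsymbol v\in\mathbb R^d$; put $\rho_A=C_A/c_A$. Let $\tilde{\boldsymbol e}\in\mathscr E$ be the weak solution of the cell problem, i.e. $(\boldsymbol A\tilde{\boldsymbol e},\boldsymbol v)_{L^2_\#(\mathcal Y;\mathbb R^d)}=-(\boldsymbol A\boldsymbol E,\boldsymbol v)_{L^2_\#(\mathcal Y;\mathbb R^d)}$ for all $\boldsymbol v\in\mathscr E$. Then for every $\boldsymbol N=(N_1,\dots,N_d)$ with all $N_\alpha$ odd positive integers there is a unique $\tilde{\boldsymbol e}^{\mathrm{Ga}}_{\boldsymbol N}\in\mathscr E_{\boldsymbol N}$ such that $$(\boldsymbol A\tilde{\boldsymbol e}^{\mathrm{Ga}}_{\boldsymbol N},\boldsymbol v_{\boldsymbol N})_{L^2_\#(\mathcal Y;\mathbb R^d)}=-(\boldsymbol A\boldsymbol E,\boldsymbol v_{\boldsymbol N})_{L^2_\#(\mathcal Y;\mathbb R^d)}\quad\text{for all }\boldsymbol v_{\boldsymbol N}\in\mathscr E_{\boldsymbol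 N},$$ and $$\lim_{\boldsymbol N\to\boldsymbol\infty}\|\tilde{\boldsymbol e}-\tilde{\boldsymbol e}^{\mathrm{Ga}}_{\boldsymbol N}\|_{L^2_\#(\mathcal Y;\mathbb R^d)}=0 .$$ If, in addition, $\tilde{\boldsymbol e}\in H^s_\#(\mathcal Y;\mathbb R^d)$ for some $s>0$, then $$\|\tilde{\boldsymbol e}-\tilde{\boldsymbol e}^{\mathrm{Ga}}_{\boldsymbol N}\|_{L^2_\#(\mathcal Y;\mathbb R^d)}\le\rho_A\,C_h^s\,\|\tilde{\boldsymbol e}\|_{H^s_\#(\mathcal Y;\mathbb R^d)} .$$
   Context: Let $\mathcal Y=\prod_{\alpha=1}^d[-Y_\alpha,Y_\alpha]\subset\mathbb R^d$ with $Y_\alpha>0$, $|\mathcal Y|=2^d\prod_\alpha Y_\alpha$. $L^p_\#(\mathcal Y;\mathbb X)$ is the space of $\mathcal Y$-periodic (period $2Y_\alpha$ in direction $\alpha$) functions $\mathbb R^d\to\mathbb X$ in $L^p_{\mathrm{loc}}$; for $p=2$ the scalar product is $(\boldsymbol u,\boldsymbol v)_{L^2_\#}=\frac1{|\mathcal Y|}\int_{\mathcal Y}(\boldsymbol u(\boldsymbol x),\boldsymbol v(\boldsymbol x))_{\mathbb X}\,d\boldsymbol x$. For $\boldsymbol k\in\mathbb Z^d$ put $\boldsymbol\xi(\boldsymbol k)=(k_\alpha/Y_\alpha)_\alpha$, $\varphi_{\boldsymbol k}(\boldsymbol x)=\exp(\mathrm i\pi\,\boldsymbol\xi(\boldsymbol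 k)\cdot\boldsymbol x)$, and $\widehat{\boldsymbol u}(\boldsymbol k)=\frac1{|\mathcal Y|}\int_{\mathcal Y}\boldsymbol u(\boldsymbol x)\varphi_{-\boldsymbol k}(\boldsymbol x)\,d\boldsymbol x$. The norm of the periodic Sobolev space $H^s_\#(\mathcal Y;\mathbb R^d)$ is $\|\boldsymbol u\|_{H^s_\#}^2=\sum_{\boldsymbol k\in\mathbb Z^d}\|\underline{\boldsymbol\xi}(\boldsymbol k)\|_{\mathbb R^d}^{2s}\|\widehat{\boldsymbol u}(\boldsymbol k)\|_{\mathbb C^d}^2$, where $\underline{\boldsymbol\xi}(\boldsymbol k)=\boldsymbol\xi(\boldsymbol k)$ for $\boldsymbol k\neq\boldsymbol 0$ and $\underline{\boldsymbol\xi}(\boldsymbol 0)=\boldsymbol 1$ (vector of ones). $\mathscr E=\{\boldsymbol u\in L^2_\#(\mathcal Y;\mathbb R^d):\nabla\times\boldsymbol u=\boldsymbol 0,\ \int_{\mathcal Y}\boldsymbol u\,d\boldsymbol x=\boldsymbol 0\}$, where $\nabla\times\boldsymbol u=\boldsymbol 0$ means $\int_{\mathcal Y}(u_\alpha\partial_\beta v-u_\beta\partial_\alpha v)\,d\boldsymbol x=0$ for all $\alpha,\beta$ and all $v\in H^1_\#(\mathcal Y)$ (real-valued). For $\boldsymbol N$ with odd entries let $\mathbb Z^d_{\boldsymbol N}=\{\boldsymbol m\in\mathbb Z^d:-N_\alpha/2\le m_\alpha<N_\alpha/2\}$, $h_\alpha=2Y_\alpha/N_\alpha$, $C_h=\max_\alpha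 h_\alpha$. The trigonometric polynomials are $\mathscr T^d_{\boldsymbol N}=\{\sum_{\boldsymbol k\in\mathbb Z^d_{\boldsymbol N}}\widehat{\boldsymbol v}^{\boldsymbol k}\varphi_{\boldsymbol k}:\widehat{\boldsymbol v}^{\boldsymbol k}\in\mathbb C^d,\ \widehat{\boldsymbol v}^{\boldsymbol k}=\overline{\widehat{\boldsymbol v}^{-\boldsymbol k}}\}$, and $\mathscr E_{\boldsymbol N}=\mathscr E\cap\mathscr T^d_{\boldsymbol N}$. The limit $\boldsymbol N\to\boldsymbol\infty$ means $\min_\alpha N_\alpha\to\infty$ (over $\boldsymbol N$ with odd entries). The vector $\boldsymbol E$ is identified with the constant field. *)

theory Defs
  imports "HOL-Analysis.Analysis"
begin

text \<open>
  The periodic cell is \<open>\<Prod>\<^sub>\<alpha> [-Y\<^sub>\<alpha>, Y\<^sub>\<alpha>]\<close> in \<open>real ^ 'n\<close>, so \<open>CARD('n)\<close> is the dimension.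
  Elements of the function spaces are functions, not classes modulo null sets; they are
  periodic at every point.
\<close>

definition cell :: "real ^ 'n \<Rightarrow> (real ^ 'n) set" where
  "cell Y = cbox (- Y) Y"

definition cell_vol :: "real ^ 'n \<Rightarrow> real" where
  "cell_vol Y = 2 ^ CARD('n) * (\<Prod>\<alpha>\<in>UNIV. Y $ \<alpha>)"

definition periodic :: "real ^ 'n \<Rightarrow> (real ^ 'n \<Rightarrow> 'b) \<Rightarrow> bool" where
  "periodic Y u \<longleftrightarrow> (\<forall>x \<alpha>. u (x + axis \<alpha> (2 * Y $ \<alpha>)) = u x)"

definition L2_per :: "real ^ 'n \<Rightarrow> (real ^ 'n \<Rightarrow> 'b::euclidean_space) set" where
  "L2_per Y = {u. u \<in> borel_measurable lebesgue \<and> periodic Y u \<and>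
     (\<forall>K. compact K \<longrightarrow> set_integrable lebesgue K (\<lambda>x. (norm (u x))\<^sup>2))}"

definition Linf_per :: "real ^ 'n \<Rightarrow> (real ^ 'n \<Rightarrow> 'b::euclidean_space) set" where
  "Linf_per Y = {u. u \<in> borel_measurable lebesgue \<and> periodic Y u \<and>
     (\<forall>K. compact K \<longrightarrow> (\<exists>C. AE x in lebesgue. x \<in> K \<longrightarrow> norm (u x) \<le> C))}"

definition L2_inner ::
    "real ^ 'n \<Rightarrow> (real ^ 'n \<Rightarrow> 'b::euclidean_space) \<Rightarrow> (real ^ 'n \<Rightarrow> 'b) \<Rightarrow> real" where
  "L2_inner Y u v = 1 / cell_vol Y * (LINT x:cell Y|lebesgue. u x \<bullet> v x)"

definition L2_norm :: "real ^ 'n \<Rightarrow> (real ^ 'n \<Rightarrow> 'b::euclidean_space) \<Rightarrow> real" where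
  "L2_norm Y u = sqrt (L2_inner Y u u)"


definition freq :: "real ^ 'n \<Rightarrow> int ^ 'n \<Rightarrow> real ^ 'n" where
  "freq Y k = (\<chi> \<alpha>. real_of_int (k $ \<alpha>) / Y $ \<alpha>)"

definition freq1 :: "real ^ 'n \<Rightarrow> int ^ 'n \<Rightarrow> real ^ 'n" where
  "freq1 Y k = (if k = 0 then (\<chi> \<alpha>. 1) else freq Y k)"

definition fourier_basis :: "real ^ 'n \<Rightarrow> int ^ 'n \<Rightarrow> real ^ 'n \<Rightarrow> complex" where
  "fourier_basis Y k x = exp (\<i> * complex_of_real (pi * (freq Y k \<bullet> x)))"

definition fourier_coeff :: "real ^ 'n \<Rightarrow> (real ^ 'n \<Rightarrow> real) \<Rightarrow> int ^ 'n \<Rightarrow> complex" where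
  "fourier_coeff Y u k = complex_of_real (1 / cell_vol Y) *
     (LINT x:cell Y|lebesgue. complex_of_real (u x) * fourier_basis Y (- k) x)"

definition fourier_coeff_vec ::
    "real ^ 'n \<Rightarrow> (real ^ 'n \<Rightarrow> real ^ 'n) \<Rightarrow> int ^ 'n \<Rightarrow> complex ^ 'n" where
  "fourier_coeff_vec Y u k = (\<chi> \<alpha>. fourier_coeff Y (\<lambda>x. u x $ \<alpha>) k)"

text \<open>
  The summand of the squared Sobolev norm for a family \<open>c\<close> of Fourier coefficients, which are
  complex numbers for scalar fields and complex vectors for vector fields.
\<close>

definition sobolev_term ::
    "real ^ 'n \<Rightarrow> real \<Rightarrow> (int ^ 'n \<Rightarrow> 'c::real_normed_vector) \<Rightarrow> int ^ 'n \<Rightarrow> real" where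
  "sobolev_term Y s c k = norm (freq1 Y k) powr (2 * s) * (norm (c k))\<^sup>2"

definition Hs_per_scalar :: "real ^ 'n \<Rightarrow> real \<Rightarrow> (real ^ 'n \<Rightarrow> real) set" where
  "Hs_per_scalar Y s = {v \<in> L2_per Y. sobolev_term Y s (fourier_coeff Y v) summable_on UNIV}"

definition Hs_per :: "real ^ 'n \<Rightarrow> real \<Rightarrow> (real ^ 'n \<Rightarrow> real ^ 'n) set" where
  "Hs_per Y s = {u \<in> L2_per Y. sobolev_term Y s (fourier_coeff_vec Y u) summable_on UNIV}"

definition Hs_norm :: "real ^ 'n \<Rightarrow> real \<Rightarrow> (real ^ 'n \<Rightarrow> real ^ 'n) \<Rightarrow> real" where
  "Hs_norm Y s u = sqrt (\<Sum>\<^sub>\<infinity>k. sobolev_term Y s (fourier_coeff_vec Y u) k)"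


definition partial_deriv :: "'n \<Rightarrow> (real ^ 'n \<Rightarrow> real) \<Rightarrow> real ^ 'n \<Rightarrow> real" where
  "partial_deriv \<alpha> f x = frechet_derivative f (at x) (axis \<alpha> 1)"

primrec Ck_fun :: "nat \<Rightarrow> (real ^ 'n \<Rightarrow> real) \<Rightarrow> bool" where
  "Ck_fun 0 f \<longleftrightarrow> continuous_on UNIV f"
| "Ck_fun (Suc m) f \<longleftrightarrow> f differentiable_on UNIV \<and> (\<forall>\<alpha>. Ck_fun m (partial_deriv \<alpha> f))"

definition smooth_per :: "real ^ 'n \<Rightarrow> (real ^ 'n \<Rightarrow> real) set" where
  "smooth_per Y = {w. periodic Y w \<and> (\<forall>m. Ck_fun m w)}"

text \<open>
  \<open>weak_partial Y \<alpha> v g\<close>: \<open>g\<close> is a square-integrable weak partial derivative of \<open>v\<close>, which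
  determines \<open>g\<close> up to a null set and exists for every \<open>v \<in> Hs_per_scalar Y 1\<close>.
\<close>

definition weak_partial ::
    "real ^ 'n \<Rightarrow> 'n \<Rightarrow> (real ^ 'n \<Rightarrow> real) \<Rightarrow> (real ^ 'n \<Rightarrow> real) \<Rightarrow> bool" where
  "weak_partial Y \<alpha> v g \<longleftrightarrow> g \<in> L2_per Y \<and>
     (\<forall>w\<in>smooth_per Y. (LINT x:cell Y|lebesgue. g x * w x) =
        - (LINT x:cell Y|lebesgue. v x * partial_deriv \<alpha> w x))"

definition curl_free :: "real ^ 'n \<Rightarrow> (real ^ 'n \<Rightarrow> real ^ 'n) \<Rightarrow> bool" where
  "curl_free Y u \<longleftrightarrow> (\<forall>\<alpha> \<beta>. \<forall>v\<in>Hs_per_scalar Y 1. \<forall>v\<alpha> v\<beta>.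
     weak_partial Y \<alpha> v v\<alpha> \<longrightarrow> weak_partial Y \<beta> v v\<beta> \<longrightarrow>
     (LINT x:cell Y|lebesgue. u x $ \<alpha> * v\<beta> x - u x $ \<beta> * v\<alpha> x) = 0)"

definition E_space :: "real ^ 'n \<Rightarrow> (real ^ 'n \<Rightarrow> real ^ 'n) set" where
  "E_space Y = {u \<in> L2_per Y. curl_free Y u \<and> (LINT x:cell Y|lebesgue. u x) = 0}"


definition odd_grid :: "nat ^ 'n \<Rightarrow> bool" where
  "odd_grid N \<longleftrightarrow> (\<forall>\<alpha>. odd (N $ \<alpha>))"

definition freq_index :: "nat ^ 'n \<Rightarrow> (int ^ 'n) set" where
  "freq_index N = {m. \<forall>\<alpha>. - real (N $ \<alpha>) / 2 \<le> real_of_int (m $ \<alpha>) \<and>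
                          real_of_int (m $ \<alpha>) < real (N $ \<alpha>) / 2}"

definition mesh_size :: "real ^ 'n \<Rightarrow> nat ^ 'n \<Rightarrow> real" where
  "mesh_size Y N = Max (range (\<lambda>\<alpha>. 2 * Y $ \<alpha> / real (N $ \<alpha>)))"

definition trig_poly :: "real ^ 'n \<Rightarrow> nat ^ 'n \<Rightarrow> (real ^ 'n \<Rightarrow> complex ^ 'n) set" where
  "trig_poly Y N = {(\<lambda>x. \<Sum>k\<in>freq_index N. fourier_basis Y k x *s c k) | c.
     \<forall>k\<in>freq_index N. c k = (\<chi> \<alpha>. cnj (c (- k) $ \<alpha>))}"

text \<open>
  Trigonometric polynomials are real-valued but are written with complex coefficients, hence
  the embedding of \<open>u\<close> into the complex vector fields.
\<close>

definition EN_space :: "real ^ 'n \<Rightarrow> nat ^ 'n \<Rightarrow> (real ^ 'n \<Rightarrow> real ^ 'n) set" where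
  "EN_space Y N = {u \<in> E_space Y. (\<lambda>x. \<chi> \<alpha>. complex_of_real (u x $ \<alpha>)) \<in> trig_poly Y N}"

definition grid_at_top :: "(nat ^ 'n) filter" where
  "grid_at_top = inf (filtercomap (\<lambda>N. Min (range (\<lambda>\<alpha>. N $ \<alpha>))) at_top)
                     (principal {N. odd_grid N})"

text \<open>
  The variational problem on a space \<open>V\<close>: the cell problem for \<open>V = E_space Y\<close>, its Galerkin
  approximation for \<open>V = EN_space Y N\<close>.
\<close>

definition solves_on :: "real ^ 'n \<Rightarrow> (real ^ 'n \<Rightarrow> real ^ 'n ^ 'n) \<Rightarrow> real ^ 'n \<Rightarrow>
    (real ^ 'n \<Rightarrow> real ^ 'n) set \<Rightarrow> (real ^ 'n \<Rightarrow> real ^ 'n) \<Rightarrow> bool" where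
  "solves_on Y A E V e \<longleftrightarrow> e \<in> V \<and>
     (\<forall>v\<in>V. L2_inner Y (\<lambda>x. A x *v e x) v = - L2_inner Y (\<lambda>x. A x *v E) v)"

end

theory Submission
  imports Defs
begin

text \<open>
  Testing curl-freeness with the trigonometric monomials shows that the Fourier coefficients of a
  field \<open>u\<close> in \<open>\<E>\<close> are parallel to the frequencies, \<open>u_hat(k) = a\<^sub>k \<xi>(k)\<close>; hence
  truncating the Fourier series maps \<open>\<E>\<close> into the Galerkin space, which consists of the real parts
  of the sums \<open>\<Sum> a\<^sub>k \<phi>\<^sub>k \<xi>(k)\<close>. Galerkin orthogonality and the symmetry of \<open>A\<close> make the Galerkin
  solution optimal in the energy norm, so its squared error is at most \<open>C\<^sub>A / c\<^sub>A\<close> times that of the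
  truncated field. The truncation error tends to zero because trigonometric polynomials are dense:
  the cell maps to a torus on which the Stone-Weierstrass theorem applies. The Sobolev rate
  holds because a frequency outside the grid has norm at least one over the mesh size.
\<close>

text \<open>Fields are functions rather than classes, and no Parseval series is summed. Its place is
  taken by \<open>defect F u\<close>, the energy of \<open>u\<close> that a finite frequency set
  \<open>F\<close> does not capture. Bessel makes it nonnegative, density makes it small for
  suitable \<open>F\<close>, and enlarging \<open>F\<close> cannot increase it; convergence and rate
  are both bounds on this one number. Curl-freeness is tested against all of H^1, and this works in
  two directions. To extract information, waves must be admissible test functions, which needs
  integration by parts without boundary terms. To show that a trigonometric gradient is curl-free,
  the derivatives of an arbitrary test function are moved onto the waves. Odd grid entries make the
  frequency set symmetric under negation, so that real parts of sums over the grid stay within the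
  grid. Density is proved on the torus because a continuous function on the cell need not match on
  opposite faces; what happens on the faces is hidden in a null set. Existence uses a spanning
  family of modes that is linearly dependent, so its Gram matrix is only semidefinite and
  solvability has to come from consistency.\<close>

locale periodic_cell =
  fixes Y :: "real ^ 'n"
  assumes Y_pos: "0 < Y $ \<alpha>"

subsection \<open>Integrals over the periodicity cell\<close>

text \<open>The shifted cell \<open>Q\<close> overhangs the face
  \<open>x $ \<alpha> = Y $ \<alpha>\<close> by a slab of width \<open>t\<close>. Translating this
  slab back by one period gives exactly the slab of the cell that \<open>Q\<close> has left, and
  \<open>f\<close> does not notice the translation. The bound on \<open>t\<close> ensures that one
  period suffices.\<close>

lemma integral_cell_shift:
  fixes f :: "real ^ 'n \<Rightarrow> 'b::euclidean_space"
  assumes per: "periodic Y f" and cont: "continuous_on UNIV f"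
    and t: "0 \<le> t" "t \<le> 2 * Y $ \<alpha>"
  shows "integral (cell Y) (\<lambda>x. f (x + t *\<^sub>R axis \<alpha> 1)) = integral (cell Y) f"
proof -
  define \<epsilon> :: "real ^ 'n" where "\<epsilon> = axis \<alpha> 1"
  define p where "p = (2 * Y $ \<alpha>) *\<^sub>R \<epsilon>"
  have \<epsilon>B: "\<epsilon> \<in> Basis" by (simp add: \<epsilon>_def)
  have inner_\<epsilon>: "x \<bullet> \<epsilon> = x $ \<alpha>" for x by (simp add: \<epsilon>_def inner_axis)
  have \<epsilon>_nth: "\<epsilon> $ i = (if i = \<alpha> then 1 else 0)" for i by (simp add: \<epsilon>_def axis_def)
  have p_eq: "p = axis \<alpha> (2 * Y $ \<alpha>)"
    by (simp add: p_def \<epsilon>_def axis_def vec_eq_iff)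
  have fper: "f (x + p) = f x" for x using per by (simp add: periodic_def p_eq)
  have int: "f integrable_on cbox a b" for a b
    by (rule integrable_continuous[OF continuous_on_subset[OF cont]]) simp
  have split: "integral (cbox a b) f = integral (cbox a b \<inter> {x. x $ \<alpha> \<le> c}) f
      + integral (cbox a b \<inter> {x. c \<le> x $ \<alpha>}) f" for a b c
  proof -
    have i1: "f integrable_on (cbox a b \<inter> {x. x \<bullet> \<epsilon> \<le> c})"
      unfolding interval_split[OF \<epsilon>B] by (rule int)
    have i2: "f integrable_on (cbox a b \<inter> {x. x \<bullet> \<epsilon> \<ge> c})"
      unfolding interval_split[OF \<epsilon>B] by (rule int)
    show ?thesis
      using has_integral_split[OF integrable_integral[OF i1] integrable_integral[OF i2] \<epsilon>B]
      by (simp add: inner_\<epsilon> integral_unique)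
  qed
  have shift: "integral ((\<lambda>x. x + c) ` S) f = integral S (\<lambda>x. f (x + c))"
    if "S = cbox a b" for S c a b
  proof -
    have "(\<lambda>x. x + c) ` S = cbox (a + c) (b + c)"
      using cbox_translation[of c a b] that by (simp add: add.commute image_def)
    then show ?thesis
      using integral_shift_cbox[of "a + c" c "b + c" f] that by simp
  qed
  let ?s = "t *\<^sub>R \<epsilon>"
  define Q where "Q = cbox (- Y + ?s) (Y + ?s)"
  have "integral (cell Y) (\<lambda>x. f (x + ?s)) = integral Q f"
    using integral_shift_cbox[of "- Y + ?s" ?s "Y + ?s" f] by (simp add: Q_def cell_def)
  also have "\<dots> = integral (Q \<inter> {x. x $ \<alpha> \<le> Y $ \<alpha>}) f + integral (Q \<inter> {x. Y $ \<alpha> \<le> x $ \<alpha>}) f"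
    unfolding Q_def by (rule split)
  also have "Q \<inter> {x. x $ \<alpha> \<le> Y $ \<alpha>} = cell Y \<inter> {x. - Y $ \<alpha> + t \<le> x $ \<alpha>}"
    using t by (auto simp: Q_def cell_def mem_box_cart \<epsilon>_nth split: if_splits)
      (smt (verit))+
  also have "Q \<inter> {x. Y $ \<alpha> \<le> x $ \<alpha>} = (\<lambda>x. x + p) ` (cell Y \<inter> {x. x $ \<alpha> \<le> - Y $ \<alpha> + t})"
  proof (intro equalityI subsetI)
    fix x assume x: "x \<in> Q \<inter> {x. Y $ \<alpha> \<le> x $ \<alpha>}"
    have "- Y $ i \<le> (x - p) $ i \<and> (x - p) $ i \<le> Y $ i" for i
    proof (cases "i = \<alpha>")
      case True
      with x t show ?thesis
        by (auto simp: Q_def mem_box_cart \<epsilon>_nth p_def split: if_splits dest!: spec[of _ \<alpha>])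
    next
      case False
      with x show ?thesis
        by (auto simp: Q_def mem_box_cart \<epsilon>_nth p_def split: if_splits dest!: spec[of _ i])
    qed
    moreover have "(x - p) $ \<alpha> \<le> - Y $ \<alpha> + t"
      using x by (auto simp: Q_def mem_box_cart \<epsilon>_nth p_def split: if_splits dest!: spec[of _ \<alpha>])
    ultimately have "x - p \<in> cell Y \<inter> {x. x $ \<alpha> \<le> - Y $ \<alpha> + t}"
      by (auto simp: cell_def mem_box_cart)
    then show "x \<in> (\<lambda>x. x + p) ` (cell Y \<inter> {x. x $ \<alpha> \<le> - Y $ \<alpha> + t})"
      by (intro image_eqI[of _ _ "x - p"]) auto
  next
    fix x assume "x \<in> (\<lambda>x. x + p) ` (cell Y \<inter> {x. x $ \<alpha> \<le> - Y $ \<alpha> + t})"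
    then obtain y where y: "x = y + p" "y \<in> cell Y" "y $ \<alpha> \<le> - Y $ \<alpha> + t" by auto
    have "(- Y + ?s) $ i \<le> x $ i \<and> x $ i \<le> (Y + ?s) $ i" for i
      using y t by (cases "i = \<alpha>") (auto simp: cell_def mem_box_cart \<epsilon>_nth p_def dest!: spec[of _ i])
    moreover have "Y $ \<alpha> \<le> x $ \<alpha>"
      using y by (auto simp: cell_def mem_box_cart \<epsilon>_nth p_def dest!: spec[of _ \<alpha>])
    ultimately show "x \<in> Q \<inter> {x. Y $ \<alpha> \<le> x $ \<alpha>}" by (auto simp: Q_def mem_box_cart)
  qed
  also have "integral \<dots> f = integral (cell Y \<inter> {x. x $ \<alpha> \<le> - Y $ \<alpha> + t}) (\<lambda>x. f (x + p))"
    by (rule shift) (simp add: cell_def interval_split[OF \<epsilon>B, unfolded inner_\<epsilon>])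
  also have "\<dots> = integral (cell Y \<inter> {x. x $ \<alpha> \<le> - Y $ \<alpha> + t}) f"
    by (simp add: fper)
  finally show ?thesis
    using split[of "- Y" Y "- Y $ \<alpha> + t"] by (simp add: \<epsilon>_def cell_def add.commute)
qed

text \<open>The integral of the shifted \<open>f\<close> is constant in the shift, so its derivative
  at 0 vanishes, and differentiation under the integral identifies that derivative with the integral
  of \<open>g\<close>. Boundary terms never appear. The derivative at 0 is one-sided because
  invariance was shown for shifts between 0 and one period.\<close>

lemma (in periodic_cell) integral_directional_derivative:
  fixes f g :: "real ^ 'n \<Rightarrow> 'b::euclidean_space"
  assumes per: "periodic Y f" and cont: "continuous_on UNIV f" "continuous_on UNIV g"
    and deriv: "\<And>x t. ((\<lambda>t. f (x + t *\<^sub>R axis \<alpha> 1)) has_vector_derivative g (x + t *\<^sub>R axis \<alpha> 1)) (at t)"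
  shows "integral (cell Y) g = 0"
proof -
  let ?T = "2 * Y $ \<alpha>"
  have T: "0 < ?T" using Y_pos[of \<alpha>] by simp
  let ?F = "\<lambda>t. integral (cbox (- Y) Y) (\<lambda>x. f (x + t *\<^sub>R axis \<alpha> 1))"
  have "(?F has_vector_derivative integral (cbox (- Y) Y) (\<lambda>x. g (x + 0 *\<^sub>R axis \<alpha> 1)))
      (at 0 within cbox 0 ?T)"
  proof (rule leibniz_rule_vector_derivative)
    show "((\<lambda>t. f (x + t *\<^sub>R axis \<alpha> 1)) has_vector_derivative g (x + t *\<^sub>R axis \<alpha> 1))
        (at t within cbox 0 ?T)" for t x
      by (rule has_vector_derivative_at_within[OF deriv])
    show "(\<lambda>x. f (x + t *\<^sub>R axis \<alpha> 1)) integrable_on cbox (- Y) Y" for t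
      by (intro integrable_continuous continuous_on_compose2[OF cont(1)] continuous_intros) auto
    show "continuous_on (cbox 0 ?T \<times> cbox (- Y) Y) (\<lambda>(t, x). g (x + t *\<^sub>R axis \<alpha> 1))"
      unfolding split_beta
      by (intro continuous_on_compose2[OF cont(2)] continuous_intros) auto
  qed (use T in auto)
  moreover have "(?F has_vector_derivative 0) (at 0 within cbox 0 ?T)"
  proof (rule has_vector_derivative_transform)
    show "((\<lambda>t. integral (cell Y) f) has_vector_derivative 0) (at 0 within cbox 0 ?T)"
      by (rule has_vector_derivative_const)
    show "?F t = integral (cell Y) f" if "t \<in> cbox 0 ?T" for t
      using integral_cell_shift[OF per cont(1), of t \<alpha>] that by (simp add: cell_def)
  qed (use T in auto)
  ultimately show ?thesis
    using vector_derivative_unique_within_closed_interval[of 0 ?T 0] T by (auto simp: cell_def)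
qed

subsection \<open>Square integrable functions\<close>

definition square_integrable :: "'a measure \<Rightarrow> ('a \<Rightarrow> 'b::euclidean_space) \<Rightarrow> bool" where
  "square_integrable M f \<longleftrightarrow> f \<in> borel_measurable M \<and> integrable M (\<lambda>x. (norm (f x))\<^sup>2)"

lemma square_integrable_mult_norm:
  assumes "square_integrable M f" "square_integrable M g"
  shows "integrable M (\<lambda>x. norm (f x) * norm (g x))"
proof (rule Bochner_Integration.integrable_bound)
  show "integrable M (\<lambda>x. (norm (f x))\<^sup>2 + (norm (g x))\<^sup>2)"
    using assms by (auto simp: square_integrable_def)
  have [measurable]: "f \<in> borel_measurable M" "g \<in> borel_measurable M"
    using assms by (auto simp: square_integrable_def)
  show "(\<lambda>x. norm (f x) * norm (g x)) \<in> borel_measurable M" by measurable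
  have "norm a * norm b \<le> (norm a)\<^sup>2 + (norm b)\<^sup>2" for a :: 'b and b :: 'c
  proof -
    have "2 * (norm a * norm b) \<le> (norm a)\<^sup>2 + (norm b)\<^sup>2"
      using sum_squares_bound[of "norm a" "norm b"] by (simp add: mult.assoc)
    moreover have "0 \<le> norm a * norm b" by simp
    ultimately show ?thesis by linarith
  qed
  then show "AE x in M. norm (norm (f x) * norm (g x)) \<le> norm ((norm (f x))\<^sup>2 + (norm (g x))\<^sup>2)"
    by simp
qed

lemma square_integrable_bilinear:
  fixes h :: "'b::euclidean_space \<Rightarrow> 'c::euclidean_space \<Rightarrow> 'd::euclidean_space"
  assumes h: "bounded_bilinear h" and f: "square_integrable M f" and g: "square_integrable M g"
    and meas: "(\<lambda>x. h (f x) (g x)) \<in> borel_measurable M"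
  shows "integrable M (\<lambda>x. h (f x) (g x))"
proof -
  obtain K where K: "\<And>a b. norm (h a b) \<le> norm a * norm b * K"
    using bounded_bilinear.bounded[OF h] by blast
  have "norm (h (f x) (g x)) \<le> norm (K * (norm (f x) * norm (g x)))" for x
    using order_trans[OF K[of "f x" "g x"] abs_ge_self] by (simp add: abs_mult mult_ac)
  then show ?thesis
    using square_integrable_mult_norm[OF f g]
    by - (rule Bochner_Integration.integrable_bound[where f = "\<lambda>x. K * (norm (f x) * norm (g x))", OF _ meas], auto)
qed

lemma square_integrable_bound:
  assumes f: "square_integrable M f" and g: "g \<in> borel_measurable M"
    and le: "AE x in M. norm (g x) \<le> K * norm (f x)"
  shows "square_integrable M g"
  unfolding square_integrable_def
proof (intro conjI g)
  have "AE x in M. norm ((norm (g x))\<^sup>2) \<le> norm (K\<^sup>2 * (norm (f x))\<^sup>2)"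
    using le by eventually_elim (simp add: power_mult_distrib[symmetric] power_mono)
  then show "integrable M (\<lambda>x. (norm (g x))\<^sup>2)"
    using f g unfolding square_integrable_def
    by - (rule Bochner_Integration.integrable_bound[where f = "\<lambda>x. K\<^sup>2 * (norm (f x))\<^sup>2"], auto)
qed

lemma norm_add_power2_le: "(norm (a + b))\<^sup>2 \<le> 2 * ((norm a)\<^sup>2 + (norm b)\<^sup>2)"
  for a b :: "'a::real_normed_vector"
proof -
  have "(norm (a + b))\<^sup>2 \<le> (norm a + norm b)\<^sup>2" by (simp add: norm_triangle_ineq power_mono)
  also have "\<dots> \<le> 2 * ((norm a)\<^sup>2 + (norm b)\<^sup>2)"
    using sum_squares_bound[of "norm a" "norm b"] by (simp add: power2_sum)
  finally show ?thesis .
qed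

lemma square_integrable_add:
  fixes f g :: "'a \<Rightarrow> 'b::euclidean_space"
  assumes f: "square_integrable M f" and g: "square_integrable M g"
  shows "square_integrable M (\<lambda>x. f x + g x)"
  unfolding square_integrable_def
proof (intro conjI)
  have [measurable]: "f \<in> borel_measurable M" "g \<in> borel_measurable M"
    using assms by (auto simp: square_integrable_def)
  show m: "(\<lambda>x. f x + g x) \<in> borel_measurable M" by measurable
  have "(norm (a + b))\<^sup>2 \<le> 2 * ((norm a)\<^sup>2 + (norm b)\<^sup>2)" for a b :: 'b
    by (rule norm_add_power2_le)
  then show "integrable M (\<lambda>x. (norm (f x + g x))\<^sup>2)"
    using f g unfolding square_integrable_def
    by - (rule Bochner_Integration.integrable_bound[where f = "\<lambda>x. 2 * ((norm (f x))\<^sup>2 + (norm (g x))\<^sup>2)"], auto)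
qed

lemma square_integrable_bounded_linear:
  assumes h: "bounded_linear h" and f: "square_integrable M f"
  shows "square_integrable M (\<lambda>x. h (f x))"
proof -
  obtain K where "\<And>x. norm (h x) \<le> norm x * K" using bounded_linear.bounded[OF h] by blast
  moreover have "(\<lambda>x. h (f x)) \<in> borel_measurable M"
    using f borel_measurable_continuous_on[OF linear_continuous_on[OF h]]
    by (auto simp: square_integrable_def)
  ultimately show ?thesis
    by (intro square_integrable_bound[OF f, of _ K]) (auto simp: mult.commute)
qed

lemma square_integrable_diff:
  assumes f: "square_integrable M f" and g: "square_integrable M g"
  shows "square_integrable M (\<lambda>x. f x - g x)"
  using square_integrable_add[OF f square_integrable_bounded_linear[OF bounded_linear_minus[OF bounded_linear_ident] g]]
  by simp

lemma (in finite_measure) square_integrable_bounded: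
  assumes "f \<in> borel_measurable M" "\<And>x. x \<in> space M \<Longrightarrow> norm (f x) \<le> B"
  shows "square_integrable M f"
  unfolding square_integrable_def
proof
  show "integrable M (\<lambda>x. (norm (f x))\<^sup>2)"
    by (rule integrable_const_bound[of _ "B\<^sup>2"]) (use assms in \<open>auto intro!: AE_I2 power_mono\<close>)
qed (rule assms)

lemma (in finite_measure) square_integrable_imp_integrable:
  fixes f :: "'a \<Rightarrow> 'b::euclidean_space"
  assumes f: "square_integrable M f"
  shows "integrable M f"
proof -
  have "square_integrable M (\<lambda>x. 1::real)" by (rule square_integrable_bounded[where B = 1]) auto
  from square_integrable_mult_norm[OF f this] have "integrable M (\<lambda>x. norm (f x))" by simp
  then show ?thesis
    by (rule integrable_norm_cancel) (use f in \<open>simp add: square_integrable_def\<close>)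
qed

lemma square_integrable_sum:
  fixes f :: "'i \<Rightarrow> 'a \<Rightarrow> 'b::euclidean_space"
  assumes "\<And>i. i \<in> I \<Longrightarrow> square_integrable M (f i)"
  shows "square_integrable M (\<lambda>x. \<Sum>i\<in>I. f i x)"
proof (cases "finite I")
  case True
  from this assms show ?thesis
  proof induction
    case (insert i I)
    have "square_integrable M (\<lambda>x. f i x + (\<Sum>i\<in>I. f i x))"
      by (intro square_integrable_add insert) (use insert in auto)
    with insert show ?case by simp
  qed (simp add: square_integrable_def)
qed (simp add: square_integrable_def)

subsection \<open>Fourier coefficients\<close>

lemma freq_add: "freq Y (k + l) = freq Y k + freq Y l"
  by (simp add: freq_def vec_eq_iff add_divide_distrib)

lemma freq_minus: "freq Y (- k) = - freq Y k"
  by (simp add: freq_def vec_eq_iff)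

lemma freq_zero [simp]: "freq Y 0 = 0"
  by (simp add: freq_def vec_eq_iff)

lemma fourier_basis_add: "fourier_basis Y (k + l) x = fourier_basis Y k x * fourier_basis Y l x"
  by (simp add: fourier_basis_def freq_add inner_add_left exp_add[symmetric] algebra_simps)

lemma fourier_basis_zero [simp]: "fourier_basis Y 0 x = 1"
  by (simp add: fourier_basis_def)

lemma norm_fourier_basis [simp]: "norm (fourier_basis Y k x) = 1"
  by (simp add: fourier_basis_def)

lemma cnj_fourier_basis: "cnj (fourier_basis Y k x) = fourier_basis Y (- k) x"
  by (simp add: fourier_basis_def exp_cnj freq_minus)

lemma continuous_on_fourier_basis [continuous_intros]: "continuous_on S (fourier_basis Y k)"
  unfolding fourier_basis_def by (intro continuous_intros)

lemma fourier_basis_measurable [measurable]: "fourier_basis Y k \<in> borel_measurable lebesgue"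
  by (intro measurable_completion) (simp add: borel_measurable_continuous_onI[OF continuous_on_fourier_basis])

lemma fourier_basis_shift:
  "fourier_basis Y k (x + y) = fourier_basis Y k x * fourier_basis Y k y"
  by (simp add: fourier_basis_def inner_add_right exp_add[symmetric] algebra_simps)

lemma fourier_basis_line:
  "((\<lambda>t. fourier_basis Y k (x + t *\<^sub>R axis \<alpha> 1)) has_vector_derivative
      \<i> * complex_of_real (pi * freq Y k $ \<alpha>) * fourier_basis Y k (x + t *\<^sub>R axis \<alpha> 1)) (at t)"
proof -
  let ?c = "\<i> * complex_of_real (pi * freq Y k $ \<alpha>)"
  have line: "fourier_basis Y k (x + t *\<^sub>R axis \<alpha> 1) = fourier_basis Y k x * exp (?c * complex_of_real t)" for t
    by (simp add: fourier_basis_def inner_add_right inner_axis exp_add[symmetric] algebra_simps)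
  have "((\<lambda>z. fourier_basis Y k x * exp (?c * z)) has_field_derivative
      ?c * (fourier_basis Y k x * exp (?c * complex_of_real t))) (at (complex_of_real t))"
    by (auto intro!: derivative_eq_intros simp: mult_ac)
  from has_vector_derivative_real_field[OF this] show ?thesis unfolding line .
qed

section \<open>Orthogonality of the exponentials and the Bessel identity on the cell\<close>

context periodic_cell
begin

abbreviation "M \<equiv> lebesgue_on (cell Y)"

lemma cell_sets [measurable, simp]: "cell Y \<in> sets lebesgue"
  by (simp add: cell_def)

lemma cell_vol_pos: "0 < cell_vol Y"
  by (auto simp: cell_vol_def intro!: mult_pos_pos prod_pos Y_pos)

lemma cell_vol_nonzero [simp]: "cell_vol Y \<noteq> 0"
  using cell_vol_pos by simp

lemma measure_lebesgue_cell: "measure lebesgue (cell Y) = cell_vol Y"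
proof -
  have "cbox (- Y) Y \<noteq> {}" using Y_pos by (auto simp: interval_ne_empty_cart intro: less_imp_le)
  then have "measure lebesgue (cell Y) = (\<Prod>i\<in>UNIV. 2 * Y $ i)"
    by (simp add: cell_def content_cbox_cart)
  then show ?thesis by (simp add: cell_vol_def prod.distrib)
qed

sublocale fm: finite_measure M
  by (rule finite_measure_lebesgue_on) (simp add: cell_def)

lemma measure_cell: "measure M (cell Y) = cell_vol Y"
  by (simp add: measure_restrict_space measure_lebesgue_cell)

lemma LINT_cell: "(LINT x:cell Y|lebesgue. f x) = integral\<^sup>L M f"
  for f :: "_ \<Rightarrow> 'b::euclidean_space"
  by (simp add: integral_restrict_space set_lebesgue_integral_def)

lemma measurable_M: "f \<in> borel_measurable lebesgue \<Longrightarrow> f \<in> borel_measurable M"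
  by (rule measurable_restrict_space1)

lemma fourier_basis_measurable_M [measurable]: "fourier_basis Y k \<in> borel_measurable M"
  by (rule measurable_M) simp

lemma square_integrable_continuous:
  fixes f :: "_ \<Rightarrow> 'b::euclidean_space"
  assumes "continuous_on UNIV f"
  shows "square_integrable M f"
proof -
  have "compact (f ` cell Y)"
    by (rule compact_continuous_image[OF continuous_on_subset[OF assms]]) (auto simp: cell_def)
  then obtain B where "\<And>x. x \<in> cell Y \<Longrightarrow> norm (f x) \<le> B"
    by (meson compact_imp_bounded bounded_iff image_eqI)
  then show ?thesis
    using continuous_imp_measurable_on_sets_lebesgue[OF continuous_on_subset[OF assms], of "cell Y"]
    by (intro fm.square_integrable_bounded) auto
qed

lemma square_integrable_fourier_basis: "square_integrable M (fourier_basis Y k)"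
  by (rule square_integrable_continuous) (intro continuous_intros)

lemma square_integrable_mult_fourier_basis:
  assumes "square_integrable M f"
  shows "square_integrable M (\<lambda>x. f x * fourier_basis Y k x)"
  by (rule square_integrable_bound[OF assms, of _ 1])
    (use assms in \<open>auto simp: norm_mult square_integrable_def\<close>)

lemma integrable_mult_fourier_basis:
  assumes "square_integrable M f"
  shows "integrable M (\<lambda>x. f x * fourier_basis Y k x)"
  by (rule fm.square_integrable_imp_integrable[OF square_integrable_mult_fourier_basis[OF assms]])

lemma integral_M_eq_HK:
  fixes f :: "_ \<Rightarrow> 'b::euclidean_space"
  assumes "continuous_on UNIV f"
  shows "integral\<^sup>L M f = integral (cell Y) f"
  by (intro lebesgue_integral_eq_integral fm.square_integrable_imp_integrable
      square_integrable_continuous assms cell_sets)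

lemma periodic_fourier_basis: "periodic Y (fourier_basis Y k)"
  unfolding periodic_def
proof safe
  fix x \<alpha>
  have "fourier_basis Y k (axis \<alpha> (2 * Y $ \<alpha>)) = exp (2 * of_int (k $ \<alpha>) * pi * \<i>)"
    using Y_pos[of \<alpha>] by (simp add: fourier_basis_def freq_def inner_axis mult_ac)
  also have "\<dots> = 1" by (rule exp_integer_2pi) simp
  finally show "fourier_basis Y k (x + axis \<alpha> (2 * Y $ \<alpha>)) = fourier_basis Y k x"
    by (simp add: fourier_basis_shift)
qed

lemma freq_eq_0_iff: "freq Y k = 0 \<longleftrightarrow> k = 0"
  using Y_pos by (auto simp: freq_def vec_eq_iff less_imp_neq[THEN not_sym])

text \<open>For \<open>k \<noteq> 0\<close> some component of \<open>freq Y k\<close> is nonzero,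
  and in that direction the exponential is, up to a nonzero factor, the derivative of a periodic
  function, namely of itself.\<close>

lemma integral_fourier_basis:
  "integral\<^sup>L M (fourier_basis Y k) = (if k = 0 then complex_of_real (cell_vol Y) else 0)"
proof (cases "k = 0")
  case True
  then have "fourier_basis Y k = (\<lambda>x. 1)" by (auto simp: fun_eq_iff)
  then show ?thesis using True measure_cell by (simp add: scaleR_conv_of_real)
next
  case False
  then obtain \<alpha> where \<alpha>: "freq Y k $ \<alpha> \<noteq> 0" using freq_eq_0_iff[of k] by (auto simp: vec_eq_iff)
  have "integral (cell Y) (\<lambda>x. \<i> * complex_of_real (pi * freq Y k $ \<alpha>) * fourier_basis Y k x) = 0"
    by (rule integral_directional_derivative[OF periodic_fourier_basis _ _ fourier_basis_line])
      (auto intro!: continuous_intros)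
  then have "integral\<^sup>L M (\<lambda>x. \<i> * complex_of_real (pi * freq Y k $ \<alpha>) * fourier_basis Y k x) = 0"
    by (subst integral_M_eq_HK) (auto intro!: continuous_intros)
  then show ?thesis using \<alpha> False by simp
qed

text \<open>Complex-valued counterpart of \<open>fourier_coeff\<close>, which takes real functions
  only; trigonometric sums with arbitrary coefficients need it.\<close>

definition coeff :: "(real ^ 'n \<Rightarrow> complex) \<Rightarrow> int ^ 'n \<Rightarrow> complex" where
  "coeff f k = integral\<^sup>L M (\<lambda>x. f x * fourier_basis Y (- k) x) / cell_vol Y"

text \<open>The squared norm of L^2, normalised by the cell volume, for scalar, complex and vector
  values alike.\<close>

definition energy :: "(real ^ 'n \<Rightarrow> 'b::euclidean_space) \<Rightarrow> real" where
  "energy f = integral\<^sup>L M (\<lambda>x. (norm (f x))\<^sup>2) / cell_vol Y"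

lemma fourier_coeff_eq: "fourier_coeff Y u k = coeff (\<lambda>x. complex_of_real (u x)) k"
  by (simp add: fourier_coeff_def coeff_def LINT_cell)

lemma energy_nonneg: "0 \<le> energy f"
  using cell_vol_pos by (simp add: energy_def)

lemma coeff_diff:
  assumes "square_integrable M f" "square_integrable M g"
  shows "coeff (\<lambda>x. f x - g x) k = coeff f k - coeff g k"
  using integrable_mult_fourier_basis[OF assms(1)] integrable_mult_fourier_basis[OF assms(2)]
  by (simp add: coeff_def left_diff_distrib diff_divide_distrib)

lemma coeff_sum:
  assumes "\<And>i. i \<in> I \<Longrightarrow> square_integrable M (f i)"
  shows "coeff (\<lambda>x. \<Sum>i\<in>I. f i x) k = (\<Sum>i\<in>I. coeff (f i) k)"
  using integrable_mult_fourier_basis[OF assms]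
  by (simp add: coeff_def sum_distrib_right sum_divide_distrib Bochner_Integration.integral_sum)

lemma coeff_cmult: "coeff (\<lambda>x. c * f x) k = c * coeff f k"
  by (simp add: coeff_def mult.assoc)

lemma coeff_fourier_basis: "coeff (fourier_basis Y l) k = (if k = l then 1 else 0)"
proof -
  have "(\<lambda>x. fourier_basis Y l x * fourier_basis Y (- k) x) = fourier_basis Y (l - k)"
    by (simp add: fun_eq_iff fourier_basis_add[symmetric])
  then show ?thesis by (auto simp: coeff_def integral_fourier_basis)
qed

lemma coeff_trig:
  assumes "finite F"
  shows "coeff (\<lambda>x. \<Sum>l\<in>F. c l * fourier_basis Y l x) k = (if k \<in> F then c k else 0)"
proof -
  have "coeff (\<lambda>x. \<Sum>l\<in>F. c l * fourier_basis Y l x) k = (\<Sum>l\<in>F. c l * (if k = l then 1 else 0))"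
    by (subst coeff_sum) (auto simp: coeff_cmult coeff_fourier_basis
        intro!: square_integrable_bounded_linear[OF bounded_linear_mult_right] square_integrable_fourier_basis)
  also have "\<dots> = (if k \<in> F then c k else 0)"
    using assms by (simp add: if_distrib sum.delta cong: if_cong)
  finally show ?thesis .
qed

lemma square_integrable_trig: "square_integrable M (\<lambda>x. \<Sum>l\<in>F. c l * fourier_basis Y l x)"
  by (intro square_integrable_sum square_integrable_bounded_linear[OF bounded_linear_mult_right]
      square_integrable_fourier_basis)

text \<open>Completing the square in \<open>c\<close>: the exponential has modulus 1, so the
  quadratic term is \<open>(norm c)\<^sup>2\<close> and the cross term is the Fourier coefficient at
  \<open>k\<close>.\<close>

lemma energy_diff_basis:
  assumes g: "square_integrable M g"
  shows "energy (\<lambda>x. g x - c * fourier_basis Y k x)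
    = energy g - (norm (coeff g k))\<^sup>2 + (norm (c - coeff g k))\<^sup>2"
proof -
  have pt: "(norm (g x - c * fourier_basis Y k x))\<^sup>2
      = (norm (g x))\<^sup>2 - 2 * Re (cnj c * (g x * fourier_basis Y (- k) x)) + (norm c)\<^sup>2" for x
  proof -
    have "(norm (a - b))\<^sup>2 = (norm a)\<^sup>2 - 2 * Re (a * cnj b) + (norm b)\<^sup>2" for a b :: complex
      by (simp add: cmod_power2) (simp add: power2_eq_square algebra_simps)
    from this[of "g x" "c * fourier_basis Y k x"] show ?thesis
      unfolding complex_cnj_mult cnj_fourier_basis by (simp only: norm_mult norm_fourier_basis mult_ac mult_1_right mult_1_left)
  qed
  have i1: "integrable M (\<lambda>x. (norm (g x))\<^sup>2)" using g by (simp add: square_integrable_def)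
  have i2: "integrable M (\<lambda>x. cnj c * (g x * fourier_basis Y (- k) x))"
    using integrable_mult_fourier_basis[OF g] by simp
  have "integral\<^sup>L M (\<lambda>x. (norm (g x - c * fourier_basis Y k x))\<^sup>2)
      = integral\<^sup>L M (\<lambda>x. (norm (g x))\<^sup>2)
        - 2 * Re (cnj c * integral\<^sup>L M (\<lambda>x. g x * fourier_basis Y (- k) x)) + cell_vol Y * (norm c)\<^sup>2"
  proof -
    define q where "q x = Re (cnj c * (g x * fourier_basis Y (- k) x))" for x
    have q: "integrable M q" unfolding q_def by (rule integrable_Re[OF i2])
    have "integral\<^sup>L M q = Re (cnj c * integral\<^sup>L M (\<lambda>x. g x * fourier_basis Y (- k) x))"
      unfolding q_def integral_Re[OF i2] by (simp only: integral_mult_right_zero)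
    moreover have "integral\<^sup>L M (\<lambda>x. (norm (g x))\<^sup>2 - 2 * q x + (norm c)\<^sup>2)
        = integral\<^sup>L M (\<lambda>x. (norm (g x))\<^sup>2) - 2 * integral\<^sup>L M q + cell_vol Y * (norm c)\<^sup>2"
      using i1 q measure_cell by simp
    ultimately show ?thesis unfolding pt q_def by simp
  qed
  then have "energy (\<lambda>x. g x - c * fourier_basis Y k x)
      = energy g - 2 * Re (cnj c * coeff g k) + (norm c)\<^sup>2"
    by (simp add: energy_def coeff_def field_simps Re_divide_of_real)
  moreover have "- 2 * Re (cnj c * coeff g k) + (norm c)\<^sup>2
      = - (norm (coeff g k))\<^sup>2 + (norm (c - coeff g k))\<^sup>2"
    by (simp add: cmod_power2) (simp add: power2_eq_square algebra_simps)
  ultimately show ?thesis by simp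
qed

text \<open>Subtracting modes in \<open>F\<close> leaves the coefficient at a new frequency
  unchanged, so the one-mode identity iterates. Taking \<open>c\<close> to be the Fourier
  coefficients gives Bessel; for arbitrary \<open>c\<close> the last sum shows that Fourier
  coefficients are the best choice.\<close>

lemma energy_diff_trig:
  assumes f: "square_integrable M f" and "finite F"
  shows "energy (\<lambda>x. f x - (\<Sum>k\<in>F. c k * fourier_basis Y k x))
    = energy f - (\<Sum>k\<in>F. (norm (coeff f k))\<^sup>2) + (\<Sum>k\<in>F. (norm (c k - coeff f k))\<^sup>2)"
  using \<open>finite F\<close>
proof induction
  case (insert k F)
  let ?g = "\<lambda>x. f x - (\<Sum>l\<in>F. c l * fourier_basis Y l x)"
  have g: "square_integrable M ?g"
    by (intro square_integrable_diff f square_integrable_trig)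
  have ck: "coeff ?g k = coeff f k"
    using insert by (simp add: coeff_diff[OF f square_integrable_trig] coeff_trig)
  have "energy (\<lambda>x. f x - (\<Sum>l\<in>insert k F. c l * fourier_basis Y l x))
      = energy (\<lambda>x. ?g x - c k * fourier_basis Y k x)"
    using insert by (simp add: algebra_simps)
  also have "\<dots> = energy ?g - (norm (coeff f k))\<^sup>2 + (norm (c k - coeff f k))\<^sup>2"
    by (simp add: energy_diff_basis[OF g] ck)
  finally show ?case using insert by simp
qed simp

end

context periodic_cell
begin

subsection \<open>Trigonometric test functions\<close>

lemma L2_per_square_integrable:
  assumes "u \<in> L2_per Y"
  shows "square_integrable M u"
proof -
  have "compact (cell Y)" by (simp add: cell_def)
  with assms show ?thesis
    by (auto simp: L2_per_def square_integrable_def set_integrable_def measurable_M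
        integrable_restrict_space)
qed

lemma L2_perI:
  fixes u :: "_ \<Rightarrow> 'b::euclidean_space"
  assumes "periodic Y u" "continuous_on UNIV u"
  shows "u \<in> L2_per Y"
proof -
  have "u \<in> borel_measurable lebesgue"
    by (intro measurable_completion) (simp add: borel_measurable_continuous_onI[OF assms(2)])
  moreover have "set_integrable lebesgue K (\<lambda>x. (norm (u x))\<^sup>2)" if "compact K" for K
  proof -
    have cont: "continuous_on K (\<lambda>x. (norm (u x))\<^sup>2)"
      by (intro continuous_intros continuous_on_subset[OF assms(2)]) auto
    have "set_integrable lborel K (\<lambda>x. (norm (u x))\<^sup>2)"
      using borel_integrable_compact[OF that cont] unfolding set_integrable_def
      by (simp add: indicator_def of_bool_def if_distrib cong: if_cong)
    then show ?thesis
      unfolding set_integrable_def using integrable_completion by (metis borel_measurable_integrable)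
  qed
  ultimately show ?thesis using assms by (simp add: L2_per_def)
qed

text \<open>The complex number \<open>c\<close> carries amplitude and phase of a real mode. This
  keeps the family closed under partial derivatives, which only multiply \<open>c\<close> by the
  symbol \<open>wave_deriv k \<alpha>\<close>.\<close>

definition wave :: "complex \<Rightarrow> int ^ 'n \<Rightarrow> real ^ 'n \<Rightarrow> real" where
  "wave c k x = Re (c * fourier_basis Y k x)"

definition wave_deriv :: "int ^ 'n \<Rightarrow> 'n \<Rightarrow> complex" where
  "wave_deriv k \<alpha> = \<i> * complex_of_real (pi * freq Y k $ \<alpha>)"

lemma continuous_wave [continuous_intros]: "continuous_on S (wave c k)"
  unfolding wave_def by (intro continuous_intros)

lemma periodic_wave: "periodic Y (wave c k)"
  using periodic_fourier_basis[of k] by (simp add: periodic_def wave_def)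

lemma wave_has_derivative:
  "(wave c k has_derivative (\<lambda>h. wave (c * (\<i> * complex_of_real (pi * (freq Y k \<bullet> h)))) k x)) (at x)"
proof -
  let ?g = "\<lambda>x. \<i> * complex_of_real (pi * (freq Y k \<bullet> x))"
  have g: "(?g has_derivative ?g) (at x)"
    by (intro bounded_linear_imp_has_derivative bounded_linear_compose[OF bounded_linear_mult_right]
        bounded_linear_compose[OF bounded_linear_of_real] bounded_linear_inner_right)
  have "(exp has_derivative (*) (exp (?g x))) (at (?g x))"
    by (rule DERIV_exp[unfolded has_field_derivative_def])
  from has_derivative_compose[OF g this]
  have "((\<lambda>x. Re (c * exp (?g x))) has_derivative (\<lambda>h. Re (c * (exp (?g x) * ?g h)))) (at x)"
    by (intro bounded_linear.has_derivative[OF bounded_linear_Re]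
        bounded_linear.has_derivative[OF bounded_linear_mult_right])
  moreover have "(\<lambda>x. Re (c * exp (?g x))) = wave c k"
    by (rule ext) (simp only: wave_def fourier_basis_def)
  moreover have "Re (c * (exp (?g x) * ?g h)) = wave (c * ?g h) k x" for h
    by (simp only: wave_def fourier_basis_def mult_ac)
  ultimately show ?thesis by simp
qed

lemma partial_deriv_wave: "partial_deriv \<alpha> (wave c k) = wave (c * wave_deriv k \<alpha>) k"
  by (simp add: fun_eq_iff partial_deriv_def frechet_derivative_at[OF wave_has_derivative, symmetric]
      wave_deriv_def inner_axis)

lemma wave_smooth: "wave c k \<in> smooth_per Y"
proof -
  have "Ck_fun m (wave c k)" for m
  proof (induction m arbitrary: c)
    case (Suc m)
    have "wave c k differentiable_on UNIV"
      using wave_has_derivative by (auto simp: differentiable_on_def differentiable_def)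
    then show ?case using Suc by (simp add: partial_deriv_wave)
  qed (auto intro: continuous_intros)
  then show ?thesis by (simp add: smooth_per_def periodic_wave)
qed

lemma wave_L2_per: "wave c k \<in> L2_per Y"
  by (intro L2_perI periodic_wave continuous_intros)

lemma wave_fourier_basis:
  "complex_of_real (wave c k x) = c / 2 * fourier_basis Y k x + cnj c / 2 * fourier_basis Y (- k) x"
proof -
  have "complex_of_real (Re z) = (z + cnj z) / 2" for z by (simp add: complex_add_cnj)
  from this[of "c * fourier_basis Y k x"] show ?thesis
    by (simp add: wave_def cnj_fourier_basis add_divide_distrib)
qed

text \<open>Only the frequencies \<open>k\<close> and \<open>- k\<close> can contribute, so the
  Sobolev series has finitely many nonzero terms. For \<open>s = 1\<close> this admits waves as test
  functions in \<open>curl_free\<close>.\<close>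

lemma wave_Hs_per: "wave c k \<in> Hs_per_scalar Y s"
proof -
  have "fourier_coeff Y (wave c k) l = 0" if "l \<notin> {k, - k}" for l
  proof -
    let ?f = "\<lambda>j x. (if j then c / 2 else cnj c / 2) * fourier_basis Y (if j then k else - k) x"
    have "fourier_coeff Y (wave c k) l = coeff (\<lambda>x. \<Sum>j\<in>{True, False}. ?f j x) l"
      by (simp add: fourier_coeff_eq wave_fourier_basis)
    also have "\<dots> = (\<Sum>j\<in>{True, False}. coeff (?f j) l)"
      by (intro coeff_sum square_integrable_bounded_linear[OF bounded_linear_mult_right]
          square_integrable_fourier_basis)
    also have "\<dots> = 0" using that by (simp add: coeff_cmult coeff_fourier_basis)
    finally show ?thesis .
  qed
  then have "{l \<in> UNIV. sobolev_term Y s (fourier_coeff Y (wave c k)) l \<noteq> 0} \<subseteq> {k, - k}"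
    by (auto simp: sobolev_term_def)
  then have "sobolev_term Y s (fourier_coeff Y (wave c k)) summable_on UNIV"
    using finite_subset[of _ "{k, - k}"] by (intro finite_nonzero_values_imp_summable_on) blast
  then show ?thesis by (simp add: Hs_per_scalar_def wave_L2_per)
qed

lemma smooth_per_line:
  assumes "w \<in> smooth_per Y"
  shows "((\<lambda>t. w (x + t *\<^sub>R axis \<alpha> 1)) has_vector_derivative partial_deriv \<alpha> w (x + t *\<^sub>R axis \<alpha> 1)) (at t)"
proof -
  let ?y = "x + t *\<^sub>R axis \<alpha> 1"
  have "Ck_fun (Suc 0) w" using assms unfolding smooth_per_def by blast
  then have "w differentiable (at ?y)" by (simp add: differentiable_on_def)
  then have D: "(w has_derivative frechet_derivative w (at ?y)) (at ?y)"
    by (simp add: frechet_derivative_works)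
  have "((\<lambda>t. x + t *\<^sub>R axis \<alpha> 1) has_derivative (\<lambda>h. h *\<^sub>R axis \<alpha> 1)) (at t)"
    by (auto intro!: derivative_eq_intros)
  from has_derivative_compose[OF this D]
  have "((\<lambda>t. w (x + t *\<^sub>R axis \<alpha> 1)) has_derivative (\<lambda>h. frechet_derivative w (at ?y) (h *\<^sub>R axis \<alpha> 1))) (at t)" .
  then show ?thesis
    by (simp add: has_vector_derivative_def partial_deriv_def
        linear_scale[OF has_derivative_linear[OF D]])
qed

lemma smooth_per_continuous:
  assumes "w \<in> smooth_per Y"
  shows "continuous_on UNIV w" "continuous_on UNIV (partial_deriv \<alpha> w)"
proof -
  have "Ck_fun 0 w" "Ck_fun (Suc 0) w" using assms unfolding smooth_per_def by blast+
  then show "continuous_on UNIV w" "continuous_on UNIV (partial_deriv \<alpha> w)" by auto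
qed

text \<open>The product of two smooth periodic functions is periodic, so the integral of its
  directional derivative vanishes; the product rule splits it into the two sides.\<close>

lemma integral_by_parts:
  assumes w: "w \<in> smooth_per Y"
  shows "integral\<^sup>L M (\<lambda>x. wave (c * wave_deriv k \<alpha>) k x * w x)
    = - integral\<^sup>L M (\<lambda>x. wave c k x * partial_deriv \<alpha> w x)"
proof -
  note cont = smooth_per_continuous[OF w]
  let ?g = "\<lambda>x. wave c k x * partial_deriv \<alpha> w x + wave (c * wave_deriv k \<alpha>) k x * w x"
  have "integral (cell Y) ?g = 0"
  proof (rule integral_directional_derivative)
    show "periodic Y (\<lambda>x. wave c k x * w x)"
      using w periodic_wave[of c k] by (simp add: smooth_per_def periodic_def)
    show "((\<lambda>t. wave c k (x + t *\<^sub>R axis \<alpha> 1) * w (x + t *\<^sub>R axis \<alpha> 1)) has_vector_derivative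
        ?g (x + t *\<^sub>R axis \<alpha> 1)) (at t)" for x t
      by (rule has_vector_derivative_mult[OF
            smooth_per_line[OF wave_smooth, unfolded partial_deriv_wave] smooth_per_line[OF w]])
  qed (auto intro!: continuous_intros cont)
  then have "integral\<^sup>L M ?g = 0"
    by (subst integral_M_eq_HK) (auto intro!: continuous_intros cont)
  moreover have "integral\<^sup>L M ?g = integral\<^sup>L M (\<lambda>x. wave c k x * partial_deriv \<alpha> w x)
      + integral\<^sup>L M (\<lambda>x. wave (c * wave_deriv k \<alpha>) k x * w x)"
    by (intro Bochner_Integration.integral_add fm.square_integrable_imp_integrable
        square_integrable_continuous continuous_intros cont)
  ultimately show ?thesis by simp
qed

lemma weak_partial_wave: "weak_partial Y \<alpha> (wave c k) (wave (c * wave_deriv k \<alpha>) k)"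
  by (auto simp: weak_partial_def LINT_cell wave_L2_per integral_by_parts)

subsection \<open>Curl-free fields in terms of Fourier coefficients\<close>

lemma square_integrable_component:
  "square_integrable M u \<Longrightarrow> square_integrable M (\<lambda>x. u x $ \<alpha> :: real)"
  by (rule square_integrable_bounded_linear[OF bounded_linear_vec_nth])

lemma square_integrable_of_real:
  "square_integrable M u \<Longrightarrow> square_integrable M (\<lambda>x. complex_of_real (u x))"
  by (rule square_integrable_bounded_linear[OF bounded_linear_of_real])

text \<open>A real test function sees only a real part of the coefficient, rotated by
  \<open>c\<close>; varying \<open>c\<close> recovers the whole complex number.\<close>

lemma integral_mult_wave:
  assumes "square_integrable M u"
  shows "integrable M (\<lambda>x. u x * wave c k x)"
    and "integral\<^sup>L M (\<lambda>x. u x * wave c k x) = cell_vol Y * Re (c * fourier_coeff Y u (- k))"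
proof -
  have i: "integrable M (\<lambda>x. c * (complex_of_real (u x) * fourier_basis Y k x))"
    by (intro integrable_mult_right integrable_mult_fourier_basis square_integrable_of_real assms)
  have eq: "u x * wave c k x = Re (c * (complex_of_real (u x) * fourier_basis Y k x))" for x
    by (simp add: wave_def algebra_simps)
  show "integrable M (\<lambda>x. u x * wave c k x)" unfolding eq by (rule integrable_Re[OF i])
  have "integral\<^sup>L M (\<lambda>x. u x * wave c k x)
      = Re (integral\<^sup>L M (\<lambda>x. c * (complex_of_real (u x) * fourier_basis Y k x)))"
    unfolding eq by (rule integral_Re[OF i])
  also have "\<dots> = Re (c * integral\<^sup>L M (\<lambda>x. complex_of_real (u x) * fourier_basis Y k x))"
    by simp
  also have "integral\<^sup>L M (\<lambda>x. complex_of_real (u x) * fourier_basis Y k x)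
      = complex_of_real (cell_vol Y) * fourier_coeff Y u (- k)"
    by (simp add: fourier_coeff_def LINT_cell)
  also have "Re (c * (complex_of_real (cell_vol Y) * fourier_coeff Y u (- k)))
      = cell_vol Y * Re (c * fourier_coeff Y u (- k))"
    by (simp add: algebra_simps)
  finally show "integral\<^sup>L M (\<lambda>x. u x * wave c k x) = cell_vol Y * Re (c * fourier_coeff Y u (- k))" .
qed

text \<open>Waves of frequency \<open>- k\<close> pick out the coefficients at \<open>k\<close>, and
  their partial derivatives contribute the frequency components. The result says that every
  two-by-two minor of the pair of coefficient vector and frequency vanishes.\<close>

lemma curl_free_coeff:
  assumes u: "square_integrable M u" and curl: "curl_free Y u"
  shows "fourier_coeff Y (\<lambda>x. u x $ \<alpha>) k * freq Y k $ \<beta> = fourier_coeff Y (\<lambda>x. u x $ \<beta>) k * freq Y k $ \<alpha>"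
proof -
  let ?a = "\<lambda>\<alpha>. fourier_coeff Y (\<lambda>x. u x $ \<alpha>) k"
  let ?z = "?a \<alpha> * freq Y k $ \<beta> - ?a \<beta> * freq Y k $ \<alpha>"
  have uc: "square_integrable M (\<lambda>x. u x $ \<alpha>)" for \<alpha> by (rule square_integrable_component[OF u])
  have "Re (c * \<i> * ?z) = 0" for c
  proof -
    let ?w = "\<lambda>\<alpha>. wave (c * wave_deriv (- k) \<alpha>) (- k)"
    have "integral\<^sup>L M (\<lambda>x. u x $ \<alpha> * ?w \<beta> x - u x $ \<beta> * ?w \<alpha> x) = 0"
      using curl weak_partial_wave wave_Hs_per unfolding curl_free_def LINT_cell by blast
    then have "cell_vol Y * Re (c * wave_deriv (- k) \<beta> * ?a \<alpha>)
        - cell_vol Y * Re (c * wave_deriv (- k) \<alpha> * ?a \<beta>) = 0"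
      using integral_mult_wave[OF uc, of _ _ "- k"] by (simp add: Bochner_Integration.integral_diff)
    then have "cell_vol Y * (- pi) * Re (c * \<i> * ?z) = 0"
      by (simp add: wave_deriv_def freq_minus algebra_simps)
    then show ?thesis using cell_vol_nonzero by (metis mult_eq_0_iff neg_equal_0_iff_equal pi_neq_zero)
  qed
  \<comment> \<open>This amplitude cancels the factor \<open>\<i>\<close> and turns the real part
    into the squared modulus of \<open>?z\<close>.\<close>
  from this[of "- \<i> * cnj ?z"] have "Re (cnj ?z * ?z) = 0" by (simp add: algebra_simps)
  then have "?z = 0" by (metis Re_complex_of_real complex_norm_square mult.commute norm_eq_zero zero_eq_power2)
  then show ?thesis by simp
qed

lemma E_space_square_integrable: "u \<in> E_space Y \<Longrightarrow> square_integrable M u"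
  by (simp add: E_space_def L2_per_square_integrable)

text \<open>For \<open>k \<noteq> 0\<close> divide by a nonzero frequency component. At
  \<open>k = 0\<close> the frequency vanishes and curl-freeness says nothing; there the zero mean
  gives a zero coefficient. Up to the factor \<open>\<i> * pi\<close>, the numbers
  \<open>a k\<close> play the role of the Fourier coefficients of a potential.\<close>

lemma E_space_coeff:
  assumes u: "u \<in> E_space Y"
  obtains a :: "int ^ 'n \<Rightarrow> complex"
    where "\<And>k \<alpha>. fourier_coeff Y (\<lambda>x. u x $ \<alpha>) k = a k * freq Y k $ \<alpha>"
proof -
  note sq = E_space_square_integrable[OF u]
  have zero: "fourier_coeff Y (\<lambda>x. u x $ \<alpha>) 0 = 0" for \<alpha>
  proof -
    have "integral\<^sup>L M u = 0" using u by (simp add: E_space_def LINT_cell)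
    then have "integral\<^sup>L M (\<lambda>x. u x $ \<alpha>) = 0"
      using integral_bounded_linear[OF bounded_linear_vec_nth fm.square_integrable_imp_integrable[OF sq], of \<alpha>]
      by simp
    then show ?thesis by (simp add: fourier_coeff_def LINT_cell)
  qed
  have "\<exists>a::complex. \<forall>\<alpha>. fourier_coeff Y (\<lambda>x. u x $ \<alpha>) k = a * freq Y k $ \<alpha>" for k
  proof (cases "k = 0")
    case False
    then obtain \<beta> where \<beta>: "freq Y k $ \<beta> \<noteq> 0" using freq_eq_0_iff[of k] by (auto simp: vec_eq_iff)
    have "fourier_coeff Y (\<lambda>x. u x $ \<alpha>) k = fourier_coeff Y (\<lambda>x. u x $ \<beta>) k / freq Y k $ \<beta> * freq Y k $ \<alpha>" for \<alpha>
      using curl_free_coeff[OF sq, of \<alpha> k \<beta>] u \<beta> by (simp add: E_space_def field_simps)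
    then show ?thesis by blast
  qed (simp add: zero)
  then show ?thesis using that by metis
qed

text \<open>No conjugation symmetry is imposed on \<open>a\<close>: the real part inside
  \<open>wave\<close> makes the field real. The price is that different \<open>a\<close> may give
  the same field, since \<open>k\<close> and \<open>- k\<close> produce the same pair of real modes
  up to sign.\<close>

definition grad_trig :: "(int ^ 'n) set \<Rightarrow> (int ^ 'n \<Rightarrow> complex) \<Rightarrow> real ^ 'n \<Rightarrow> real ^ 'n" where
  "grad_trig F a x = (\<Sum>k\<in>F. wave (a k) k x *\<^sub>R freq Y k)"

lemma grad_trig_nth: "grad_trig F a x $ \<alpha> = (\<Sum>k\<in>F. freq Y k $ \<alpha> * wave (a k) k x)"
  by (simp add: grad_trig_def mult.commute)

lemma continuous_grad_trig: "continuous_on UNIV (grad_trig F a)"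
  unfolding grad_trig_def by (intro continuous_intros)

lemma grad_trig_L2_per: "grad_trig F a \<in> L2_per Y"
  using periodic_wave
  by (intro L2_perI continuous_grad_trig) (simp add: periodic_def grad_trig_def)

lemma integral_wave: "k \<noteq> 0 \<Longrightarrow> integral\<^sup>L M (wave c k) = 0"
proof -
  assume "k \<noteq> 0"
  then have "Re (integral\<^sup>L M (\<lambda>x. c * fourier_basis Y k x)) = 0"
    by (simp add: integral_fourier_basis)
  moreover have "integrable M (\<lambda>x. c * fourier_basis Y k x)"
    by (intro integrable_mult_right fm.square_integrable_imp_integrable square_integrable_fourier_basis)
  ultimately show ?thesis unfolding wave_def by (simp only: integral_Re)
qed

text \<open>Each wave is a smooth test function for the weak partials of \<open>v\<close>, so both
  derivatives move onto the waves. The remaining terms are \<open>v\<close> integrated against mixed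
  second derivatives of a potential, which agree in either order. The mean vanishes because the mode
  \<open>k = 0\<close> has zero direction vector and all others have zero integral.\<close>

lemma grad_trig_E_space: "grad_trig F a \<in> E_space Y"
proof -
  have wave: "integrable M (wave c k)" for c k
    by (intro fm.square_integrable_imp_integrable square_integrable_continuous continuous_intros)
  have "integral\<^sup>L M (grad_trig F a) = (\<Sum>k\<in>F. integral\<^sup>L M (\<lambda>x. wave (a k) k x *\<^sub>R freq Y k))"
    unfolding grad_trig_def by (intro Bochner_Integration.integral_sum integrable_scaleR_left wave)
  also have "\<dots> = (\<Sum>k\<in>F. integral\<^sup>L M (wave (a k) k) *\<^sub>R freq Y k)"
    by (intro sum.cong refl integral_scaleR_left wave)
  also have "\<dots> = 0"
    by (intro sum.neutral ballI) (metis freq_zero integral_wave scaleR_zero_left scaleR_zero_right)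
  finally have mean: "integral\<^sup>L M (grad_trig F a) = 0" .
  have "curl_free Y (grad_trig F a)"
    unfolding curl_free_def
  proof (intro allI ballI impI)
    fix \<alpha> \<beta> v va vb
    assume v: "v \<in> Hs_per_scalar Y 1" and va: "weak_partial Y \<alpha> v va" and vb: "weak_partial Y \<beta> v vb"
    have test: "integral\<^sup>L M (\<lambda>x. g x * wave c k x) = - integral\<^sup>L M (\<lambda>x. v x * wave (c * wave_deriv k \<gamma>) k x)"
      if "weak_partial Y \<gamma> v g" for g c k \<gamma>
      using bspec[OF conjunct2[OF that[unfolded weak_partial_def LINT_cell]] wave_smooth[of c k]]
      unfolding partial_deriv_wave .
    have comp: "integrable M (\<lambda>x. grad_trig F a x $ \<gamma> * g x) \<and>
        integral\<^sup>L M (\<lambda>x. grad_trig F a x $ \<gamma> * g x) = (\<Sum>k\<in>F. freq Y k $ \<gamma> * integral\<^sup>L M (\<lambda>x. g x * wave (a k) k x))"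
      if "weak_partial Y \<delta> v g" for g \<gamma> \<delta>
    proof -
      have g: "square_integrable M g" using that by (auto simp: weak_partial_def L2_per_square_integrable)
      have "grad_trig F a x $ \<gamma> * g x = (\<Sum>k\<in>F. freq Y k $ \<gamma> * (g x * wave (a k) k x))" for x
        unfolding grad_trig_nth sum_distrib_right by (intro sum.cong refl) (simp add: mult_ac)
      then show ?thesis
        using integral_mult_wave(1)[OF g] by (simp add: Bochner_Integration.integral_sum)
    qed
    \<comment> \<open>Symmetry of mixed derivatives: both factors amount to the product of the
      frequency components in directions \<alpha> and \<beta>.\<close>
    have scale: "freq Y k $ \<alpha> * integral\<^sup>L M (\<lambda>x. v x * wave (c * wave_deriv k \<beta>) k x)
        = freq Y k $ \<beta> * integral\<^sup>L M (\<lambda>x. v x * wave (c * wave_deriv k \<alpha>) k x)" for c k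
    proof -
      have "freq Y k $ \<alpha> * (v x * wave (c * wave_deriv k \<beta>) k x) = freq Y k $ \<beta> * (v x * wave (c * wave_deriv k \<alpha>) k x)" for x
        by (simp add: wave_def wave_deriv_def algebra_simps)
      then show ?thesis by (simp only: integral_mult_right_zero[symmetric])
    qed
    have "integral\<^sup>L M (\<lambda>x. grad_trig F a x $ \<alpha> * vb x - grad_trig F a x $ \<beta> * va x) = 0"
      using comp[OF va, of \<beta>] comp[OF vb, of \<alpha>]
      by (simp add: Bochner_Integration.integral_diff test[OF va] test[OF vb] scale)
    then show "(LINT x:cell Y|lebesgue. grad_trig F a x $ \<alpha> * vb x - grad_trig F a x $ \<beta> * va x) = 0"
      by (simp add: LINT_cell)
  qed
  then show ?thesis using mean by (simp add: E_space_def LINT_cell grad_trig_L2_per)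
qed

end

subsection \<open>Density of the trigonometric polynomials\<close>

context periodic_cell
begin

text \<open>Unlike in \<open>trig_poly\<close>, the frequency set is arbitrary and there is no
  reality condition, so that these functions form an algebra.\<close>

definition is_trig :: "(real ^ 'n \<Rightarrow> complex) \<Rightarrow> bool" where
  "is_trig p \<longleftrightarrow> (\<exists>F c. finite F \<and> p = (\<lambda>x. \<Sum>k\<in>F. c k * fourier_basis Y k x))"

lemma is_trig_basis: "is_trig (\<lambda>x. c * fourier_basis Y k x)"
  unfolding is_trig_def by (rule exI[of _ "{k}"], rule exI[of _ "\<lambda>_. c"]) auto

lemma is_trig_const: "is_trig (\<lambda>x. c)"
  using is_trig_basis[of c 0] by simp

lemma is_trig_add:
  assumes "is_trig p" "is_trig q"
  shows "is_trig (\<lambda>x. p x + q x)"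
proof -
  obtain F c G d where F: "finite F" "p = (\<lambda>x. \<Sum>k\<in>F. c k * fourier_basis Y k x)"
    and G: "finite G" "q = (\<lambda>x. \<Sum>k\<in>G. d k * fourier_basis Y k x)"
    using assms unfolding is_trig_def by blast
  have 1: "p x = (\<Sum>k\<in>F \<union> G. (if k \<in> F then c k else 0) * fourier_basis Y k x)" for x
    unfolding F(2) by (rule sum.mono_neutral_cong_left) (use F G in auto)
  have 2: "q x = (\<Sum>k\<in>F \<union> G. (if k \<in> G then d k else 0) * fourier_basis Y k x)" for x
    unfolding G(2) by (rule sum.mono_neutral_cong_left) (use F G in auto)
  have "(\<lambda>x. p x + q x) = (\<lambda>x. \<Sum>k\<in>F \<union> G.
      ((if k \<in> F then c k else 0) + (if k \<in> G then d k else 0)) * fourier_basis Y k x)"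
    unfolding 1 2 by (simp only: distrib_right sum.distrib)
  then show ?thesis using F(1) G(1) unfolding is_trig_def
    by (intro exI[of _ "F \<union> G"] exI[of _ "\<lambda>k. (if k \<in> F then c k else 0) + (if k \<in> G then d k else 0)"]) simp
qed

lemma is_trig_sum:
  assumes "\<And>i. i \<in> I \<Longrightarrow> is_trig (p i)"
  shows "is_trig (\<lambda>x. \<Sum>i\<in>I. p i x)"
proof (cases "finite I")
  case True
  from this assms show ?thesis
    by induction (simp_all add: is_trig_const is_trig_add)
qed (simp add: is_trig_const)

lemma is_trig_mult:
  assumes "is_trig p" "is_trig q"
  shows "is_trig (\<lambda>x. p x * q x)"
proof -
  obtain F c G d where F: "finite F" "p = (\<lambda>x. \<Sum>k\<in>F. c k * fourier_basis Y k x)"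
    and G: "finite G" "q = (\<lambda>x. \<Sum>k\<in>G. d k * fourier_basis Y k x)"
    using assms unfolding is_trig_def by blast
  have "p x * q x = (\<Sum>k\<in>F. \<Sum>l\<in>G. (c k * d l) * fourier_basis Y (k + l) x)" for x
    unfolding F G sum_product fourier_basis_add by (intro sum.cong refl) (simp only: mult_ac)
  then show ?thesis by (simp add: is_trig_sum is_trig_basis)
qed

lemma is_trig_cos_sin:
  "is_trig (\<lambda>x. complex_of_real (cos (pi * x $ i / Y $ i)))"
  "is_trig (\<lambda>x. complex_of_real (sin (pi * x $ i / Y $ i)))"
proof -
  let ?k = "axis i 1 :: int ^ 'n"
  have fr: "freq Y ?k \<bullet> x = x $ i / Y $ i" for x
  proof -
    have "freq Y ?k = axis i (1 / Y $ i)" by (simp add: freq_def axis_def vec_eq_iff)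
    then show ?thesis by (simp add: inner_axis')
  qed
  have b: "fourier_basis Y ?k x = cis (pi * x $ i / Y $ i)"
    "fourier_basis Y (- ?k) x = cis (- (pi * x $ i / Y $ i))" for x
    by (simp_all add: fourier_basis_def freq_minus fr cis_conv_exp)
  have "complex_of_real (cos t) = 1 / 2 * cis t + 1 / 2 * cis (- t)"
    "complex_of_real (sin t) = - \<i> / 2 * cis t + \<i> / 2 * cis (- t)" for t
    by (simp_all add: complex_eq_iff)
  then show "is_trig (\<lambda>x. complex_of_real (cos (pi * x $ i / Y $ i)))"
    "is_trig (\<lambda>x. complex_of_real (sin (pi * x $ i / Y $ i)))"
    unfolding b[symmetric] by (simp_all only: b[symmetric] is_trig_add is_trig_basis)
qed

text \<open>One circle per direction, cosines in the first factor and sines in the second. Opposite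
  faces have equal images, so functions of \<open>torus x\<close> are periodic; and the coordinates
  are trigonometric polynomials, so polynomials in them are as well.\<close>

definition torus :: "real ^ 'n \<Rightarrow> (real ^ 'n) \<times> (real ^ 'n)" where
  "torus x = (\<chi> i. cos (pi * x $ i / Y $ i), \<chi> i. sin (pi * x $ i / Y $ i))"

lemma continuous_torus: "continuous_on S torus"
  unfolding torus_def using Y_pos
  by (intro continuous_intros) (auto simp: less_imp_neq[THEN not_sym])

text \<open>Equal sines and cosines force coordinates to differ by a multiple of the period. As
  opposite faces are glued, one point has to be interior: then the difference is strictly below one
  period, and the multiple is 0.\<close>

lemma torus_inj:
  assumes "x \<in> box (- Y) Y" "y \<in> cell Y" "torus x = torus y"
  shows "x = y"
  unfolding vec_eq_iff
proof
  fix i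
  let ?a = "pi * x $ i / Y $ i" and ?b = "pi * y $ i / Y $ i"
  have Yi: "0 < Y $ i" by (rule Y_pos)
  have "sin ?b = sin ?a \<and> cos ?b = cos ?a" using assms(3) by (auto simp: torus_def vec_eq_iff)
  then obtain n :: int where n: "?b = ?a + 2 * pi * n" by (auto simp: sin_cos_eq_iff)
  have "y $ i = x $ i + 2 * n * Y $ i"
  proof -
    have "pi * (y $ i) = pi * (x $ i + 2 * n * Y $ i)" using n Yi by (simp add: field_simps)
    then show ?thesis by (metis mult_cancel_left pi_neq_zero)
  qed
  moreover have "\<bar>x $ i\<bar> < Y $ i" "\<bar>y $ i\<bar> \<le> Y $ i"
    using assms(1,2) by (auto simp: cell_def mem_box_cart abs_le_iff abs_less_iff
        dest!: spec[of _ i])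
  ultimately have "\<bar>real_of_int n * Y $ i\<bar> < 1 * Y $ i" by linarith
  then have "\<bar>real_of_int n\<bar> < 1" using Yi by (simp only: abs_mult abs_of_pos mult_less_cancel_right_pos)
  then have "n = 0" by linarith
  then show "x $ i = y $ i" using \<open>y $ i = _\<close> by simp
qed

lemma is_trig_polynomial_torus:
  assumes "real_polynomial_function p"
  shows "is_trig (\<lambda>x. complex_of_real (p (torus x)))"
  using assms
proof induction
  case (linear h)
  have "is_trig (\<lambda>x. complex_of_real (torus x \<bullet> b))" if "b \<in> Basis" for b
    using that is_trig_cos_sin
    by (auto simp: Basis_prod_def Basis_vec_def torus_def inner_axis)
  moreover have "complex_of_real (h (torus x)) = (\<Sum>b\<in>Basis. complex_of_real (h b) * complex_of_real (torus x \<bullet> b))" for x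
  proof -
    have "h (torus x) = h (\<Sum>b\<in>Basis. (torus x \<bullet> b) *\<^sub>R b)" by (simp only: euclidean_representation)
    also have "\<dots> = (\<Sum>b\<in>Basis. h b * (torus x \<bullet> b))"
      by (simp add: linear_sum[OF bounded_linear.linear[OF linear]]
          linear_scale[OF bounded_linear.linear[OF linear]] mult.commute)
    finally show ?thesis by simp
  qed
  ultimately show ?case by (simp only: is_trig_sum is_trig_mult is_trig_const)
qed (simp_all add: is_trig_const is_trig_add is_trig_mult)

section \<open>From uniform approximation on the torus to mean-square approximation\<close>

lemma energy_add_le:
  fixes f g :: "real ^ 'n \<Rightarrow> 'b::euclidean_space"
  assumes f: "square_integrable M f" and g: "square_integrable M g"
  shows "energy (\<lambda>x. f x + g x) \<le> 2 * (energy f + energy g)"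
proof -
  have "(norm (a + b))\<^sup>2 \<le> 2 * ((norm a)\<^sup>2 + (norm b)\<^sup>2)" for a b :: 'b
    by (rule norm_add_power2_le)
  then have "integral\<^sup>L M (\<lambda>x. (norm (f x + g x))\<^sup>2) \<le> integral\<^sup>L M (\<lambda>x. 2 * ((norm (f x))\<^sup>2 + (norm (g x))\<^sup>2))"
    using square_integrable_add[OF f g] f g unfolding square_integrable_def
    by (intro integral_mono) auto
  also have "\<dots> = 2 * (integral\<^sup>L M (\<lambda>x. (norm (f x))\<^sup>2) + integral\<^sup>L M (\<lambda>x. (norm (g x))\<^sup>2))"
    using f g unfolding square_integrable_def by simp
  finally have "integral\<^sup>L M (\<lambda>x. (norm (f x + g x))\<^sup>2) / cell_vol Y
      \<le> 2 * (integral\<^sup>L M (\<lambda>x. (norm (f x))\<^sup>2) + integral\<^sup>L M (\<lambda>x. (norm (g x))\<^sup>2)) / cell_vol Y"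
    using cell_vol_pos by (intro divide_right_mono) auto
  then show ?thesis unfolding energy_def by (simp add: add_divide_distrib)
qed

definition trig_approximable :: "(real ^ 'n \<Rightarrow> complex) \<Rightarrow> bool" where
  "trig_approximable f \<longleftrightarrow> square_integrable M f \<and>
    (\<forall>\<epsilon>>0. \<exists>p. is_trig p \<and> energy (\<lambda>x. f x - p x) < \<epsilon>)"

lemma is_trig_square_integrable: "is_trig p \<Longrightarrow> square_integrable M p"
  by (auto simp: is_trig_def square_integrable_trig)

lemma trig_approximable_limit:
  assumes f: "square_integrable M f"
    and g: "\<And>\<epsilon>. 0 < \<epsilon> \<Longrightarrow> \<exists>g. trig_approximable g \<and> energy (\<lambda>x. f x - g x) < \<epsilon>"
  shows "trig_approximable f"
  unfolding trig_approximable_def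
proof (intro conjI f allI impI)
  fix \<epsilon> :: real assume \<epsilon>: "0 < \<epsilon>"
  \<comment> \<open>The quarters pay for the factor 2 in \<open>energy_add_le\<close>.\<close>
  obtain g where g: "trig_approximable g" "energy (\<lambda>x. f x - g x) < \<epsilon> / 4"
    using g[of "\<epsilon> / 4"] \<epsilon> by auto
  have "0 < \<epsilon> / 4" using \<epsilon> by simp
  then obtain p where p: "is_trig p" "energy (\<lambda>x. g x - p x) < \<epsilon> / 4"
    using g(1) unfolding trig_approximable_def by blast
  have sg: "square_integrable M g" using g(1) by (simp add: trig_approximable_def)
  have "energy (\<lambda>x. (f x - g x) + (g x - p x)) \<le> 2 * (energy (\<lambda>x. f x - g x) + energy (\<lambda>x. g x - p x))"
    by (rule energy_add_le[OF square_integrable_diff[OF f sg]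
          square_integrable_diff[OF sg is_trig_square_integrable[OF p(1)]]])
  then show "\<exists>p. is_trig p \<and> energy (\<lambda>x. f x - p x) < \<epsilon>" using g(2) p by (intro exI[of _ p]) simp
qed

lemma trig_approximable_add:
  assumes f: "trig_approximable f" and g: "trig_approximable g"
  shows "trig_approximable (\<lambda>x. f x + g x)"
  unfolding trig_approximable_def
proof (intro conjI allI impI)
  have sq: "square_integrable M f" "square_integrable M g"
    using f g by (auto simp: trig_approximable_def)
  then show "square_integrable M (\<lambda>x. f x + g x)" by (rule square_integrable_add)
  fix \<epsilon> :: real assume "0 < \<epsilon>"
  then have "0 < \<epsilon> / 4" by simp
  then obtain p q where p: "is_trig p" "energy (\<lambda>x. f x - p x) < \<epsilon> / 4"
    and q: "is_trig q" "energy (\<lambda>x. g x - q x) < \<epsilon> / 4"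
    using f g unfolding trig_approximable_def by metis
  have "energy (\<lambda>x. (f x - p x) + (g x - q x)) \<le> 2 * (energy (\<lambda>x. f x - p x) + energy (\<lambda>x. g x - q x))"
    by (intro energy_add_le square_integrable_diff sq is_trig_square_integrable p q)
  then have "energy (\<lambda>x. (f x + g x) - (p x + q x)) < \<epsilon>" using p q by (simp add: algebra_simps)
  then show "\<exists>p. is_trig p \<and> energy (\<lambda>x. f x + g x - p x) < \<epsilon>"
    using is_trig_add[OF p(1) q(1)] by blast
qed

lemma energy_cmult: "energy (\<lambda>x. c * f x) = (norm c)\<^sup>2 * energy f" for f :: "real ^ 'n \<Rightarrow> complex"
  by (simp add: energy_def norm_mult power_mult_distrib)

lemma trig_approximable_cmult:
  assumes f: "trig_approximable f"
  shows "trig_approximable (\<lambda>x. c * f x)"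
  unfolding trig_approximable_def
proof (intro conjI allI impI)
  show "square_integrable M (\<lambda>x. c * f x)"
    using f by (auto simp: trig_approximable_def intro: square_integrable_bounded_linear[OF bounded_linear_mult_right])
  fix \<epsilon> :: real assume \<epsilon>: "0 < \<epsilon>"
  \<comment> \<open>The summand 1 keeps the tolerance well defined when
    \<open>c = 0\<close>.\<close>
  have pos: "0 < (norm c)\<^sup>2 + 1" by (simp add: add_nonneg_pos)
  then have "0 < \<epsilon> / ((norm c)\<^sup>2 + 1)" using \<epsilon> by simp
  then obtain p where p: "is_trig p" "energy (\<lambda>x. f x - p x) < \<epsilon> / ((norm c)\<^sup>2 + 1)"
    using f unfolding trig_approximable_def by blast
  have "energy (\<lambda>x. c * f x - c * p x) = (norm c)\<^sup>2 * energy (\<lambda>x. f x - p x)"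
    using energy_cmult[of c "\<lambda>x. f x - p x"] by (simp only: right_diff_distrib)
  also have "\<dots> \<le> ((norm c)\<^sup>2 + 1) * energy (\<lambda>x. f x - p x)"
    by (intro mult_right_mono energy_nonneg) simp
  also have "\<dots> < \<epsilon>" using p(2) pos by (simp add: field_simps)
  finally show "\<exists>p. is_trig p \<and> energy (\<lambda>x. c * f x - p x) < \<epsilon>"
    using is_trig_mult[OF is_trig_const p(1)] by blast
qed

lemma trig_approximable_sum:
  assumes "\<And>i. i \<in> I \<Longrightarrow> trig_approximable (f i)"
  shows "trig_approximable (\<lambda>x. \<Sum>i\<in>I. f i x)"
proof -
  have zero: "trig_approximable (\<lambda>x. 0)"
    by (auto simp: trig_approximable_def square_integrable_def energy_def
        intro!: exI[of _ "\<lambda>x. 0"] is_trig_const)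
  show ?thesis
  proof (cases "finite I")
    case True
    from this assms show ?thesis
      by induction (simp_all add: zero trig_approximable_add)
  qed (simp add: zero)
qed

lemma energy_bound:
  fixes f :: "real ^ 'n \<Rightarrow> 'b::euclidean_space"
  assumes "AE x in M. (norm (f x))\<^sup>2 \<le> g x" "integrable M g"
  shows "energy f \<le> integral\<^sup>L M g / cell_vol Y"
proof -
  have "AE x in M. 0 \<le> g x"
    using assms(1) by eventually_elim (metis order_trans zero_le_power2)
  then have "integral\<^sup>L M (\<lambda>x. (norm (f x))\<^sup>2) \<le> integral\<^sup>L M g"
    by (rule integral_mono_AE'[OF assms(2,1)])
  then show ?thesis unfolding energy_def using cell_vol_pos by (simp add: divide_right_mono)
qed

lemma trig_approximable_continuous_torus:
  fixes g :: "(real ^ 'n) \<times> (real ^ 'n) \<Rightarrow> real"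
  assumes g: "continuous_on UNIV g"
  shows "trig_approximable (\<lambda>x. complex_of_real (g (torus x)))"
  unfolding trig_approximable_def
proof (intro conjI allI impI)
  show "square_integrable M (\<lambda>x. complex_of_real (g (torus x)))"
    by (intro square_integrable_continuous continuous_intros continuous_on_compose2[OF g continuous_torus]) auto
  fix \<epsilon> :: real assume \<epsilon>: "0 < \<epsilon>"
  have "compact (torus ` cell Y)"
    by (intro compact_continuous_image continuous_torus) (simp add: cell_def)
  \<comment> \<open>A uniform error below this root has energy at most
    \<open>\<epsilon> / 2\<close>, because the energy is a mean over the cell.\<close>
  moreover have "0 < sqrt (\<epsilon> / 2)" using \<epsilon> by simp
  ultimately obtain p where p: "real_polynomial_function p"
    "\<And>y. y \<in> torus ` cell Y \<Longrightarrow> \<bar>g y - p y\<bar> < sqrt (\<epsilon> / 2)"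
    using Stone_Weierstrass_real_polynomial_function[of "torus ` cell Y" g "sqrt (\<epsilon> / 2)"]
      continuous_on_subset[OF g] by blast
  have "energy (\<lambda>x. complex_of_real (g (torus x)) - complex_of_real (p (torus x)))
      \<le> integral\<^sup>L M (\<lambda>x. \<epsilon> / 2) / cell_vol Y"
  proof (rule energy_bound)
    show "AE x in M. (norm (complex_of_real (g (torus x)) - complex_of_real (p (torus x))))\<^sup>2 \<le> \<epsilon> / 2"
    proof (rule AE_I2)
      fix x assume "x \<in> space M"
      then have "\<bar>g (torus x) - p (torus x)\<bar> < sqrt (\<epsilon> / 2)" using p(2) by simp
      then have "\<bar>g (torus x) - p (torus x)\<bar>\<^sup>2 \<le> (sqrt (\<epsilon> / 2))\<^sup>2" by (intro power_mono) auto
      then show "(norm (complex_of_real (g (torus x)) - complex_of_real (p (torus x))))\<^sup>2 \<le> \<epsilon> / 2"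
        using \<epsilon> by (simp flip: of_real_diff)
    qed
  qed simp
  also have "\<dots> < \<epsilon>" using \<epsilon> measure_cell cell_vol_pos by simp
  finally show "\<exists>p. is_trig p \<and> energy (\<lambda>x. complex_of_real (g (torus x)) - p x) < \<epsilon>"
    using is_trig_polynomial_torus[OF p(1)] by blast
qed

text \<open>Regularity of Lebesgue measure encloses the interior part of \<open>A\<close> between a
  compact \<open>K\<close> and an open \<open>U\<close>, and a Urysohn function separates
  \<open>K\<close> from the complement of \<open>U\<close>. The separation is done on the torus, so
  that the function is periodic and Stone-Weierstrass applies to it.\<close>

lemma trig_approximable_indicator:
  assumes A: "A \<in> sets lebesgue" "A \<subseteq> cell Y"
  shows "trig_approximable (\<lambda>x. complex_of_real (indicator A x))"
proof (rule trig_approximable_limit)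
  have Am: "A \<in> sets M" using A by (simp add: sets_restrict_space_iff)
  then have [measurable]: "indicator A \<in> borel_measurable M" by simp
  show "square_integrable M (\<lambda>x. complex_of_real (indicator A x))"
  proof (rule fm.square_integrable_bounded[where B = 1])
    show "(\<lambda>x. complex_of_real (indicator A x)) \<in> borel_measurable M" by measurable
  qed (auto simp: indicator_def)
  fix \<epsilon> :: real assume \<epsilon>: "0 < \<epsilon>"
  define B where "B = box (- Y) Y"
  \<comment> \<open>Two exceptional sets of measure at most \<delta> then cost
    \<open>2 * \<epsilon> / 3\<close> after normalisation.\<close>
  define \<delta> where "\<delta> = \<epsilon> * cell_vol Y / 3"
  have \<delta>: "0 < \<delta>" using \<epsilon> cell_vol_pos by (simp add: \<delta>_def)
  have BY: "B \<subseteq> cell Y" by (auto simp: B_def cell_def box_subset_cbox)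
  have AB: "A \<inter> B \<in> sets lebesgue" using A by (auto simp: B_def)
  obtain K where K: "closed K" "K \<subseteq> A \<inter> B" "(A \<inter> B) - K \<in> lmeasurable"
    "emeasure lebesgue ((A \<inter> B) - K) < ennreal \<delta>"
    by (rule sets_lebesgue_inner_closed[OF AB \<delta>])
  obtain V where V: "open V" "A \<inter> B \<subseteq> V" "V - (A \<inter> B) \<in> lmeasurable"
    "emeasure lebesgue (V - (A \<inter> B)) < ennreal \<delta>"
    by (rule sets_lebesgue_outer_open[OF AB \<delta>])
  define U where "U = V \<inter> B"
  have openU: "open U" by (auto simp: U_def B_def V)
  have ABU: "A \<inter> B \<subseteq> U" using V by (auto simp: U_def)
  have cpt: "compact (cell Y)" by (simp add: cell_def)
  have cK: "compact K"
    using compact_Int_closed[OF cpt K(1)] K(2) BY by (simp add: Int_absorb1 subset_trans[OF K(2)] le_infI2)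
  have cU: "compact (cell Y - U)" using cpt openU by (rule compact_diff)
  \<comment> \<open>This is why \<open>A\<close> was cut down to the open box: \<open>K\<close>
    consists of interior points, whose images no other point of the cell shares.\<close>
  have disj: "torus ` K \<inter> torus ` (cell Y - U) = {}"
  proof -
    have False if "x \<in> K" "y \<in> cell Y - U" "torus x = torus y" for x y
      using torus_inj[of x y] that K(2) ABU by (auto simp: B_def)
    then show ?thesis by blast
  qed
  obtain g where g: "continuous_on UNIV g" "\<And>z. g z \<in> closed_segment 1 (0::real)"
    "\<And>z. z \<in> torus ` K \<Longrightarrow> g z = 1" "\<And>z. z \<in> torus ` (cell Y - U) \<Longrightarrow> g z = 0"
    by (rule Urysohn[OF compact_imp_closed[OF compact_continuous_image[OF continuous_torus cK]]
        compact_imp_closed[OF compact_continuous_image[OF continuous_torus cU]] disj, of 1 0]) blast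
  have g01: "0 \<le> g z \<and> g z \<le> 1" for z using g(2)[of z] by (simp add: closed_segment_eq_real_ivl)
  \<comment> \<open>An interior point off \<open>R\<close> lies in \<open>K\<close>, where both
    functions are 1, or outside both \<open>A\<close> and \<open>U\<close>, where both are 0. The
    faces of the cell form a null set.\<close>
  define R where "R = ((A \<inter> B) - K) \<union> (V - (A \<inter> B))"
  have Rm: "R \<in> lmeasurable" using K(3) V(3) by (auto simp: R_def)
  have Rle: "measure lebesgue R \<le> 2 * \<delta>"
  proof -
    have "measure lebesgue ((A \<inter> B) - K) \<le> \<delta>" "measure lebesgue (V - (A \<inter> B)) \<le> \<delta>"
      using K(4) V(4) \<delta> by (auto simp: measure_def intro!: enn2real_leI)
    then show ?thesis using measure_Un_le[of "(A \<inter> B) - K" lebesgue "V - (A \<inter> B)"] K(3) V(3)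
      by (simp add: R_def)
  qed
  have "negligible (cell Y - B)"
    using negligible_frontier_interval[of "- Y" Y] by (simp add: cell_def B_def)
  then have N: "cell Y - B \<in> null_sets lebesgue" by (simp add: negligible_iff_null_sets)
  have "AE x in lebesgue. x \<in> cell Y \<longrightarrow> x \<in> B"
    using AE_not_in[OF N] by eventually_elim auto
  then have AEB: "AE x in M. x \<in> B" by (subst AE_restrict_space_iff) auto
  have "energy (\<lambda>x. complex_of_real (indicator A x) - complex_of_real (g (torus x)))
      \<le> integral\<^sup>L M (indicator R) / cell_vol Y"
  proof (rule energy_bound)
    show "AE x in M. (norm (complex_of_real (indicator A x) - complex_of_real (g (torus x))))\<^sup>2 \<le> indicator R x"
      using AEB AE_space
    proof eventually_elim
      case (elim x)
      then have xC: "x \<in> cell Y" by simp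
      have n: "norm (complex_of_real (indicator A x) - complex_of_real (g (torus x)))
          = \<bar>indicator A x - g (torus x)\<bar>" by (simp flip: of_real_diff)
      show ?case
      proof (cases "x \<in> R")
        case True
        have "\<bar>indicator A x - g (torus x)\<bar> \<le> 1"
          using g01[of "torus x"] by (auto simp: indicator_def)
        then show ?thesis using True unfolding n by (simp add: abs_square_le_1)
      next
        case False
        then have "x \<in> K \<or> x \<in> cell Y - U \<and> x \<notin> A"
          using elim xC V(2) by (auto simp: R_def U_def)
        then have "indicator A x - g (torus x) = 0"
          using K(2) g(3)[OF imageI, of x] g(4)[OF imageI, of x] by (auto simp: indicator_def)
        then show ?thesis unfolding n by simp
      qed
    qed
    show "integrable M (indicator R :: _ \<Rightarrow> real)"
    proof (rule fm.integrable_const_bound[of _ 1])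
      show "indicator R \<in> borel_measurable M"
        using fmeasurableD[OF Rm] by (intro measurable_M) simp
    qed (simp add: indicator_def)
  qed
  also have "integral\<^sup>L M (indicator R) / cell_vol Y \<le> 2 * \<delta> / cell_vol Y"
  proof -
    have "integral\<^sup>L M (indicator R) = measure lebesgue (cell Y \<inter> R)"
      by (simp add: measure_restrict_space Int_commute)
    also have "\<dots> \<le> measure lebesgue R"
      by (intro measure_mono_fmeasurable Rm) (use Rm in \<open>auto simp: fmeasurableD\<close>)
    finally show ?thesis using Rle cell_vol_pos by (simp add: divide_right_mono)
  qed
  also have "\<dots> < \<epsilon>" using \<epsilon> by (simp add: \<delta>_def)
  finally show "\<exists>g. trig_approximable g \<and> energy (\<lambda>x. complex_of_real (indicator A x) - g x) < \<epsilon>"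
    using trig_approximable_continuous_torus[OF g(1)] by blast
qed

text \<open>Simple functions on the cell are finite combinations of indicators, hence approximable,
  and dominated convergence brings them close to \<open>f\<close> in energy.\<close>

theorem trig_dense:
  assumes f: "square_integrable M f"
  shows "trig_approximable f"
proof (rule trig_approximable_limit[OF f])
  fix \<epsilon> :: real assume \<epsilon>: "0 < \<epsilon>"
  have fm: "f \<in> borel_measurable M" using f by (simp add: square_integrable_def)
  obtain s where s: "\<And>i. simple_function M (s i)" "\<And>x. x \<in> space M \<Longrightarrow> (\<lambda>i. s i x) \<longlonglongrightarrow> f x"
    "\<And>i x. x \<in> space M \<Longrightarrow> norm (s i x) \<le> 2 * norm (f x)"
    using borel_measurable_implies_sequence_metric[OF fm, of 0] unfolding dist_norm diff_0_right
    by metis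
  have sm [measurable]: "s i \<in> borel_measurable M" for i
    by (rule borel_measurable_simple_function[OF s(1)])
  have "(\<lambda>i. integral\<^sup>L M (\<lambda>x. (norm (f x - s i x))\<^sup>2)) \<longlonglongrightarrow> integral\<^sup>L M (\<lambda>x. 0)"
  proof (rule integral_dominated_convergence)
    \<comment> \<open>The approximants satisfy \<open>norm (s i x) \<le> 2 * norm (f x)\<close>, so
      the difference is at most three times \<open>norm (f x)\<close>; 9 is its square.\<close>
    show "integrable M (\<lambda>x. 9 * (norm (f x))\<^sup>2)" using f by (simp add: square_integrable_def)
    show "(\<lambda>x. (norm (f x - s i x))\<^sup>2) \<in> borel_measurable M" for i using fm by measurable
    show "AE x in M. (\<lambda>i. (norm (f x - s i x))\<^sup>2) \<longlonglongrightarrow> 0"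
    proof (rule AE_I2)
      fix x assume "x \<in> space M"
      then have "(\<lambda>i. (norm (f x - s i x))\<^sup>2) \<longlonglongrightarrow> (norm (f x - f x))\<^sup>2"
        by (intro tendsto_intros s(2))
      then show "(\<lambda>i. (norm (f x - s i x))\<^sup>2) \<longlonglongrightarrow> 0" by simp
    qed
    show "AE x in M. norm ((norm (f x - s i x))\<^sup>2) \<le> 9 * (norm (f x))\<^sup>2" for i
    proof (rule AE_I2)
      fix x assume "x \<in> space M"
      then have "norm (f x - s i x) \<le> 3 * norm (f x)"
        using norm_triangle_ineq4[of "f x" "s i x"] s(3)[of x i] by simp
      then have "(norm (f x - s i x))\<^sup>2 \<le> (3 * norm (f x))\<^sup>2" by (intro power_mono) auto
      then show "norm ((norm (f x - s i x))\<^sup>2) \<le> 9 * (norm (f x))\<^sup>2" by (simp add: power_mult_distrib)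
    qed
  qed simp
  from tendsto_divide[OF this tendsto_const[of "cell_vol Y"]]
  have "(\<lambda>i. energy (\<lambda>x. f x - s i x)) \<longlonglongrightarrow> 0" by (simp add: energy_def)
  from order_tendstoD(2)[OF this \<epsilon>] obtain i where i: "energy (\<lambda>x. f x - s i x) < \<epsilon>"
    by (auto simp: eventually_sequentially)
  let ?t = "\<lambda>x. \<Sum>y\<in>s i ` cell Y. y * complex_of_real (indicator (s i -` {y} \<inter> cell Y) x)"
  have "trig_approximable ?t"
  proof (intro trig_approximable_sum trig_approximable_cmult trig_approximable_indicator)
    show "s i -` {y} \<inter> cell Y \<in> sets lebesgue" for y
      using simple_functionD(2)[OF s(1)[of i], of "{y}"] by (simp add: sets_restrict_space_iff)
  qed auto
  moreover have "energy (\<lambda>x. f x - ?t x) < \<epsilon>"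
  proof -
    have "f x - ?t x = f x - s i x" if "x \<in> space M" for x
    proof -
      have "s i x = (\<Sum>y\<in>s i ` space M. indicator (s i -` {y} \<inter> space M) x *\<^sub>R y)"
        by (rule simple_function_indicator_representation_banach[OF s(1) that])
      also have "\<dots> = ?t x" by (intro sum.cong) (auto simp: indicator_def)
      finally show ?thesis by (rule arg_cong[where f = "\<lambda>z. f x - z", OF sym])
    qed
    then have "energy (\<lambda>x. f x - ?t x) = energy (\<lambda>x. f x - s i x)"
      unfolding energy_def
      by (intro arg_cong2[where f = "(/)"] refl Bochner_Integration.integral_cong) (simp only:)
    with i show ?thesis by simp
  qed
  ultimately show "\<exists>g. trig_approximable g \<and> energy (\<lambda>x. f x - g x) < \<epsilon>" by blast
qed

end

subsection \<open>Solvability of semidefinite systems\<close>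

lemma sum_insert_quadratic:
  fixes G :: "'i \<Rightarrow> 'i \<Rightarrow> real"
  assumes "finite S" "b \<notin> S" "\<And>i. i \<in> S \<Longrightarrow> G b i = G i b"
  shows "(\<Sum>i\<in>insert b S. \<Sum>j\<in>insert b S. c i * c j * G i j)
    = (c b)\<^sup>2 * G b b + 2 * c b * (\<Sum>i\<in>S. c i * G i b) + (\<Sum>i\<in>S. \<Sum>j\<in>S. c i * c j * G i j)"
proof -
  have 1: "(\<Sum>j\<in>S. c b * c j * G b j) = c b * (\<Sum>i\<in>S. c i * G i b)"
    using assms(3) by (simp add: sum_distrib_left mult.assoc)
  have 2: "(\<Sum>i\<in>S. c i * c b * G i b) = c b * (\<Sum>i\<in>S. c i * G i b)"
    by (simp add: sum_distrib_left mult_ac)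
  show ?thesis
    unfolding sum.insert[OF assms(1,2)] sum.distrib 1 2 power2_eq_square by (simp add: algebra_simps)
qed

text \<open>The last hypothesis says that the right-hand side annihilates the null vectors of the
  form, which is the consistency condition for a symmetric semidefinite matrix. The induction adds
  one index \<open>b\<close> at a time and eliminates it by a Schur complement.\<close>

lemma semidefinite_system_solvable:
  fixes G :: "'i \<Rightarrow> 'i \<Rightarrow> real"
  assumes "finite S"
    and "\<And>i j. i \<in> S \<Longrightarrow> j \<in> S \<Longrightarrow> G i j = G j i"
    and "\<And>c. 0 \<le> (\<Sum>i\<in>S. \<Sum>j\<in>S. c i * c j * G i j)"
    and "\<And>c. (\<Sum>i\<in>S. \<Sum>j\<in>S. c i * c j * G i j) = 0 \<Longrightarrow> (\<Sum>i\<in>S. c i * l i) = 0"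
  shows "\<exists>c. \<forall>i\<in>S. (\<Sum>j\<in>S. G i j * c j) = l i"
  using assms
proof (induction S arbitrary: l rule: finite_induct)
  case (insert b S)
  note sym = insert.prems(1) and psd = insert.prems(2) and ker = insert.prems(3)
  have symb: "G b i = G i b" if "i \<in> S" for i using sym that by blast
  have quad: "(\<Sum>i\<in>insert b S. \<Sum>j\<in>insert b S. c i * c j * G i j)
      = (c b)\<^sup>2 * G b b + 2 * c b * (\<Sum>i\<in>S. c i * G i b) + (\<Sum>i\<in>S. \<Sum>j\<in>S. c i * c j * G i j)" for c
    by (rule sum_insert_quadratic[OF insert.hyps(1,2)]) (rule symb)
  have restrict: "(\<Sum>i\<in>S. \<Sum>j\<in>S. (c(b := t)) i * (c(b := t)) j * G i j) = (\<Sum>i\<in>S. \<Sum>j\<in>S. c i * c j * G i j)"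
    "(\<Sum>i\<in>S. (c(b := t)) i * m i) = (\<Sum>i\<in>S. c i * m i)" for c t and m :: "'i \<Rightarrow> real"
    using insert.hyps(2) by (auto intro!: sum.cong)
  have psdS: "0 \<le> (\<Sum>i\<in>S. \<Sum>j\<in>S. c i * c j * G i j)" for c
    using psd[of "c(b := 0)"] unfolding quad restrict by simp
  have solve: "\<exists>c. \<forall>i\<in>S. (\<Sum>j\<in>S. G i j * c j) = m i"
    if "\<And>c. (\<Sum>i\<in>S. \<Sum>j\<in>S. c i * c j * G i j) = 0 \<Longrightarrow> (\<Sum>i\<in>S. c i * m i) = 0" for m
    using insert.IH[of m] sym psdS that by blast
  have "\<exists>u. \<forall>i\<in>S. (\<Sum>j\<in>S. G i j * u j) = l i"
  proof (rule solve)
    fix c assume "(\<Sum>i\<in>S. \<Sum>j\<in>S. c i * c j * G i j) = 0"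
    then show "(\<Sum>i\<in>S. c i * l i) = 0"
      using ker[of "c(b := 0)"] insert.hyps unfolding quad restrict by (simp add: restrict(2) del: fun_upd_apply) simp
  qed
  then obtain u where u: "\<And>i. i \<in> S \<Longrightarrow> (\<Sum>j\<in>S. G i j * u j) = l i" by blast
  \<comment> \<open>The new column is itself a consistent right-hand side: if a null vector paired
    with it to a nonzero \<open>?r\<close>, the form would be negative at a suitable multiple
    \<open>s\<close> of the new coordinate.\<close>
  have "\<exists>p. \<forall>i\<in>S. (\<Sum>j\<in>S. G i j * p j) = G i b"
  proof (rule solve)
    fix c assume z: "(\<Sum>i\<in>S. \<Sum>j\<in>S. c i * c j * G i j) = 0"
    let ?r = "\<Sum>i\<in>S. c i * G i b"
    have nn: "0 \<le> s\<^sup>2 * G b b + 2 * s * ?r" for s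
      using psd[of "c(b := s)"] z unfolding quad restrict by simp
    show "?r = 0"
    proof (rule ccontr)
      assume r: "?r \<noteq> 0"
      \<comment> \<open>A positive bound above \<open>G b b\<close>; then
        \<open>s = - (?r / g)\<close> makes the quadratic at most
        \<open>- (?r\<^sup>2 / g)\<close>.\<close>
      define g where "g = \<bar>G b b\<bar> + 1"
      have g: "0 < g" "G b b < g" by (auto simp: g_def)
      have "0 \<le> (- (?r / g))\<^sup>2 * G b b + 2 * (- (?r / g)) * ?r" by (rule nn)
      also have "\<dots> \<le> (- (?r / g))\<^sup>2 * g + 2 * (- (?r / g)) * ?r"
        using g by (intro add_right_mono mult_left_mono) auto
      also have "\<dots> = - (?r\<^sup>2 / g)" using g by (simp add: power2_eq_square field_simps)
      also have "\<dots> < 0" using r g by simp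
      finally show False by simp
    qed
  qed
  then obtain p where p: "\<And>i. i \<in> S \<Longrightarrow> (\<Sum>j\<in>S. G i j * p j) = G i b" by blast
  \<comment> \<open>The Schur complement of the block over \<open>S\<close>; \<open>r\<close> below
    is the residual that \<open>u\<close> leaves in row \<open>b\<close>.\<close>
  define \<gamma> where "\<gamma> = G b b - (\<Sum>j\<in>S. G b j * p j)"
  define r where "r = l b - (\<Sum>i\<in>S. p i * l i)"
  have Gp: "(\<Sum>j\<in>S. G b j * p j) = (\<Sum>i\<in>S. p i * G i b)"
    using symb by (intro sum.cong) auto
  have pGp: "(\<Sum>i\<in>S. \<Sum>j\<in>S. p i * p j * G i j) = (\<Sum>i\<in>S. p i * G i b)"
  proof (intro sum.cong refl)
    fix i assume "i \<in> S"
    have "(\<Sum>j\<in>S. p i * p j * G i j) = p i * (\<Sum>j\<in>S. G i j * p j)"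
      by (simp add: sum_distrib_left mult_ac)
    with p[OF \<open>i \<in> S\<close>] show "(\<Sum>j\<in>S. p i * p j * G i j) = p i * G i b" by simp
  qed
  have Gu: "(\<Sum>j\<in>S. G b j * u j) = (\<Sum>i\<in>S. p i * l i)"
  proof -
    have "(\<Sum>j\<in>S. G b j * u j) = (\<Sum>j\<in>S. (\<Sum>i\<in>S. G j i * p i) * u j)"
      using symb p by (intro sum.cong) auto
    also have "\<dots> = (\<Sum>j\<in>S. \<Sum>i\<in>S. p i * (G i j * u j))"
      unfolding sum_distrib_right using sym by (intro sum.cong refl) auto
    also have "\<dots> = (\<Sum>i\<in>S. p i * (\<Sum>j\<in>S. G i j * u j))"
      by (subst sum.swap) (simp add: sum_distrib_left)
    also have "\<dots> = (\<Sum>i\<in>S. p i * l i)" using u by simp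
    finally show ?thesis .
  qed
  \<comment> \<open>The vector with entry 1 at \<open>b\<close> and \<open>- p\<close> on
    \<open>S\<close> has form value \<gamma>. If that is 0, the consistency hypothesis applies to
    it, and its pairing with \<open>l\<close> is \<open>r\<close>.\<close>
  have r0: "r = 0" if "\<gamma> = 0"
  proof -
    let ?q = "(\<lambda>i. - p i)(b := 1)"
    have "(\<Sum>i\<in>insert b S. \<Sum>j\<in>insert b S. ?q i * ?q j * G i j) = \<gamma>"
      unfolding quad restrict by (simp add: \<gamma>_def Gp pGp sum_negf)
    with that have "(\<Sum>i\<in>insert b S. ?q i * l i) = 0" using ker[of ?q] by simp
    moreover have "(\<Sum>i\<in>insert b S. ?q i * l i) = l b + (\<Sum>i\<in>S. ?q i * l i)"
      using insert.hyps by simp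
    ultimately show ?thesis unfolding restrict by (simp add: r_def sum_negf)
  qed
  \<comment> \<open>For \<open>\<gamma> = 0\<close> division yields 0, and
    \<open>t * \<gamma> = r\<close> still holds because then \<open>r = 0\<close>.\<close>
  define t where "t = r / \<gamma>"
  have t: "t * \<gamma> = r" using r0 by (auto simp: t_def)
  let ?c = "(\<lambda>j. u j - t * p j)(b := t)"
  have row: "(\<Sum>j\<in>insert b S. G i j * ?c j) = (\<Sum>j\<in>S. G i j * u j) + t * (G i b - (\<Sum>j\<in>S. G i j * p j))" for i
  proof -
    have "(\<Sum>j\<in>S. G i j * ?c j) = (\<Sum>j\<in>S. G i j * u j - t * (G i j * p j))"
      using insert.hyps(2) by (intro sum.cong) (auto simp: algebra_simps)
    then show ?thesis using insert.hyps
      by (simp add: sum_subtractf sum_distrib_left algebra_simps)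
  qed
  have "(\<Sum>j\<in>insert b S. G i j * ?c j) = l i" if "i \<in> insert b S" for i
  proof (cases "i = b")
    case True
    then show ?thesis unfolding row using t by (simp add: Gu \<gamma>_def[symmetric] r_def)
  next
    case False
    then show ?thesis using that unfolding row by (simp add: u p)
  qed
  then show ?case by blast
qed simp

subsection \<open>Galerkin spaces\<close>

lemma finite_freq_index: "finite (freq_index N :: (int ^ 'n) set)"
proof (rule finite_subset)
  let ?S = "Pi\<^sub>E UNIV (\<lambda>\<alpha>::'n. {- int (N $ \<alpha>)..int (N $ \<alpha>)})"
  show "finite ((\<lambda>f. \<chi> \<alpha>. f \<alpha>) ` ?S)" by (intro finite_imageI finite_PiE) auto
  show "freq_index N \<subseteq> (\<lambda>f. \<chi> \<alpha>. f \<alpha>) ` ?S"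
  proof
    fix m :: "int ^ 'n" assume m: "m \<in> freq_index N"
    have "- int (N $ \<alpha>) \<le> m $ \<alpha> \<and> m $ \<alpha> \<le> int (N $ \<alpha>)" for \<alpha>
    proof -
      have "- real (N $ \<alpha>) / 2 \<le> real_of_int (m $ \<alpha>)" "real_of_int (m $ \<alpha>) < real (N $ \<alpha>) / 2"
        using m by (auto simp: freq_index_def)
      then show ?thesis by linarith
    qed
    then show "m \<in> (\<lambda>f. \<chi> \<alpha>. f \<alpha>) ` ?S"
      by (intro image_eqI[of _ _ "\<lambda>\<alpha>. m $ \<alpha>"]) (auto simp: vec_eq_iff)
  qed
qed

text \<open>The half-open range is asymmetric only through its left end point, and an odd entry of
  \<open>N\<close> keeps integers away from it.\<close>

lemma freq_index_odd_iff:
  assumes "odd_grid N"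
  shows "m \<in> freq_index N \<longleftrightarrow> (\<forall>\<alpha>. 2 * \<bar>m $ \<alpha>\<bar> < int (N $ \<alpha>))"
proof -
  have "(- real (N $ \<alpha>) / 2 \<le> real_of_int (m $ \<alpha>) \<and> real_of_int (m $ \<alpha>) < real (N $ \<alpha>) / 2)
      \<longleftrightarrow> 2 * \<bar>m $ \<alpha>\<bar> < int (N $ \<alpha>)" for \<alpha>
  proof -
    have "odd (int (N $ \<alpha>))" using assms by (simp add: odd_grid_def)
    then have "2 * m $ \<alpha> \<noteq> - int (N $ \<alpha>)" by presburger
    then show ?thesis by linarith
  qed
  then show ?thesis by (simp add: freq_index_def)
qed

lemma freq_index_uminus:
  "odd_grid N \<Longrightarrow> m \<in> freq_index N \<Longrightarrow> - m \<in> freq_index N"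
  by (simp add: freq_index_odd_iff)

context periodic_cell
begin

text \<open>Forwards, the coefficients of a trigonometric polynomial are its Fourier coefficients,
  hence parallel to the frequencies. Backwards, each wave is half an exponential plus half its
  conjugate; reflecting the conjugate half by \<open>k\<close> to \<open>- k\<close>, which stays
  within an odd grid, gives coefficients with the required symmetry.\<close>

lemma EN_space_iff:
  assumes N: "odd_grid N"
  shows "u \<in> EN_space Y N \<longleftrightarrow> (\<exists>a. u = grad_trig (freq_index N) a)"
proof
  let ?Z = "freq_index N :: (int ^ 'n) set"
  assume u: "u \<in> EN_space Y N"
  then obtain c where c: "\<And>x. (\<chi> \<alpha>. complex_of_real (u x $ \<alpha>)) = (\<Sum>k\<in>?Z. fourier_basis Y k x *s c k)"
    by (auto simp: EN_space_def trig_poly_def fun_eq_iff)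
  have ux: "complex_of_real (u x $ \<alpha>) = (\<Sum>k\<in>?Z. c k $ \<alpha> * fourier_basis Y k x)" for x \<alpha>
    using arg_cong[OF c[of x], of "\<lambda>v. v $ \<alpha>"] by (simp add: mult.commute)
  obtain a :: "int ^ 'n \<Rightarrow> complex"
    where a: "\<And>k \<alpha>. fourier_coeff Y (\<lambda>x. u x $ \<alpha>) k = a k * freq Y k $ \<alpha>"
    using E_space_coeff[of u] u by (auto simp: EN_space_def)
  have ca: "c k $ \<alpha> = a k * freq Y k $ \<alpha>" if "k \<in> ?Z" for k \<alpha>
    using a[of \<alpha> k] that by (simp add: fourier_coeff_eq ux coeff_trig finite_freq_index)
  have "u x $ \<alpha> = grad_trig ?Z a x $ \<alpha>" for x \<alpha>
  proof -
    have "u x $ \<alpha> = Re (\<Sum>k\<in>?Z. c k $ \<alpha> * fourier_basis Y k x)"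
      by (metis Re_complex_of_real ux)
    also have "\<dots> = grad_trig ?Z a x $ \<alpha>"
      by (simp add: grad_trig_nth ca wave_def algebra_simps)
    finally show ?thesis .
  qed
  then show "\<exists>a. u = grad_trig ?Z a" by (intro exI[of _ a]) (simp add: fun_eq_iff vec_eq_iff)
next
  let ?Z = "freq_index N :: (int ^ 'n) set"
  assume "\<exists>a. u = grad_trig ?Z a"
  then obtain a where u: "u = grad_trig ?Z a" by blast
  \<comment> \<open>The minus sign arises from \<open>freq Y (- k) = - freq Y k\<close>.\<close>
  define c where "c k = (\<chi> \<alpha>. freq Y k $ \<alpha> * ((a k - cnj (a (- k))) / 2))" for k
  have herm: "c k = (\<chi> \<alpha>. cnj (c (- k) $ \<alpha>))" for k
    by (simp add: c_def freq_minus vec_eq_iff algebra_simps)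
  have "(\<lambda>x. \<chi> \<alpha>. complex_of_real (u x $ \<alpha>)) = (\<lambda>x. \<Sum>k\<in>?Z. fourier_basis Y k x *s c k)"
  proof (intro ext)
    fix x
    have "complex_of_real (u x $ \<alpha>) = (\<Sum>k\<in>?Z. fourier_basis Y k x *s c k) $ \<alpha>" for \<alpha>
    proof -
      have refl: "(\<Sum>k\<in>?Z. f (- k)) = (\<Sum>k\<in>?Z. f k)" for f :: "int ^ 'n \<Rightarrow> complex"
        by (rule sum.reindex_bij_witness[of _ uminus uminus]) (use freq_index_uminus[OF N] in auto)
      have "complex_of_real (u x $ \<alpha>)
          = (\<Sum>k\<in>?Z. freq Y k $ \<alpha> * (a k / 2 * fourier_basis Y k x))
            + (\<Sum>k\<in>?Z. freq Y k $ \<alpha> * (cnj (a k) / 2 * fourier_basis Y (- k) x))"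
        unfolding u grad_trig_nth of_real_sum of_real_mult wave_fourier_basis distrib_left sum.distrib ..
      also have "(\<Sum>k\<in>?Z. freq Y k $ \<alpha> * (cnj (a k) / 2 * fourier_basis Y (- k) x))
          = (\<Sum>k\<in>?Z. - freq Y k $ \<alpha> * (cnj (a (- k)) / 2 * fourier_basis Y k x))"
        by (subst refl[symmetric]) (simp add: freq_minus)
      also have "(\<Sum>k\<in>?Z. freq Y k $ \<alpha> * (a k / 2 * fourier_basis Y k x)) + \<dots>
          = (\<Sum>k\<in>?Z. fourier_basis Y k x * c k $ \<alpha>)"
        unfolding sum.distrib[symmetric] by (intro sum.cong) (auto simp: c_def field_simps)
      finally show ?thesis by simp
    qed
    then show "(\<chi> \<alpha>. complex_of_real (u x $ \<alpha>)) = (\<Sum>k\<in>?Z. fourier_basis Y k x *s c k)"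
      by (simp add: vec_eq_iff)
  qed
  then show "u \<in> EN_space Y N"
    using herm grad_trig_E_space unfolding EN_space_def trig_poly_def u by blast
qed

subsection \<open>Truncation error\<close>

definition defect :: "(int ^ 'n) set \<Rightarrow> (real ^ 'n \<Rightarrow> real ^ 'n) \<Rightarrow> real" where
  "defect F u = energy u - (\<Sum>k\<in>F. (norm (fourier_coeff_vec Y u k))\<^sup>2)"

lemma norm_vec_power2: "(norm v)\<^sup>2 = (\<Sum>\<alpha>\<in>UNIV. (norm (v $ \<alpha>))\<^sup>2)" for v :: "'a::real_normed_vector ^ 'n"
  by (simp add: norm_vec_def L2_set_def sum_nonneg)

lemma energy_components:
  fixes u :: "real ^ 'n \<Rightarrow> real ^ 'n"
  assumes "square_integrable M u"
  shows "energy u = (\<Sum>\<alpha>\<in>UNIV. energy (\<lambda>x. complex_of_real (u x $ \<alpha>)))"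
proof -
  have "integrable M (\<lambda>x. (norm (complex_of_real (u x $ \<alpha>)))\<^sup>2)" for \<alpha>
    using square_integrable_of_real[OF square_integrable_component[OF assms]]
    unfolding square_integrable_def by blast
  then show ?thesis
    unfolding energy_def norm_vec_power2
    by (simp add: Bochner_Integration.integral_sum sum_divide_distrib)
qed

lemma defect_components:
  assumes "square_integrable M u"
  shows "defect F u = (\<Sum>\<alpha>\<in>UNIV. energy (\<lambda>x. complex_of_real (u x $ \<alpha>))
    - (\<Sum>k\<in>F. (norm (coeff (\<lambda>x. complex_of_real (u x $ \<alpha>)) k))\<^sup>2))"
  unfolding defect_def energy_components[OF assms] norm_vec_power2
  by (subst sum.swap) (simp add: sum_subtractf fourier_coeff_vec_def fourier_coeff_eq)

lemma defect_nonneg: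
  assumes u: "square_integrable M u" and F: "finite F"
  shows "0 \<le> defect F u"
  unfolding defect_components[OF u]
proof (intro sum_nonneg)
  fix \<alpha>
  let ?f = "\<lambda>x. complex_of_real (u x $ \<alpha>)"
  have "energy (\<lambda>x. ?f x - (\<Sum>k\<in>F. coeff ?f k * fourier_basis Y k x)) = energy ?f - (\<Sum>k\<in>F. (norm (coeff ?f k))\<^sup>2)"
    by (simp add: energy_diff_trig[OF square_integrable_of_real[OF square_integrable_component[OF u]] F])
  then show "0 \<le> energy ?f - (\<Sum>k\<in>F. (norm (coeff ?f k))\<^sup>2)"
    using energy_nonneg[of "\<lambda>x. ?f x - (\<Sum>k\<in>F. coeff ?f k * fourier_basis Y k x)"] by linarith
qed

lemma defect_mono:
  assumes "F \<subseteq> G" "finite G"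
  shows "defect G u \<le> defect F u"
  unfolding defect_def using sum_mono2[OF assms(2,1), of "\<lambda>k. (norm (fourier_coeff_vec Y u k))\<^sup>2"] by simp

text \<open>Parseval in finite form. An approximating sum may carry any coefficients, but Fourier
  coefficients do at least as well on the same frequencies. Each component brings its own frequency
  set; their union serves all, since more frequencies never increase the remainder.\<close>

lemma defect_small:
  assumes u: "square_integrable M u" and \<epsilon>: "0 < \<epsilon>"
  obtains F where "finite F" "defect F u < \<epsilon>"
proof -
  let ?f = "\<lambda>\<alpha> x. complex_of_real (u x $ \<alpha>)"
  let ?\<epsilon> = "\<epsilon> / CARD('n)"
  have \<epsilon>': "0 < ?\<epsilon>" using \<epsilon> by simp
  have "\<exists>F. finite F \<and> energy (?f \<alpha>) - (\<Sum>k\<in>F. (norm (coeff (?f \<alpha>) k))\<^sup>2) < ?\<epsilon>" for \<alpha>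
  proof -
    have sq: "square_integrable M (?f \<alpha>)"
      by (rule square_integrable_of_real[OF square_integrable_component[OF u]])
    then obtain F c where F: "finite F" "energy (\<lambda>x. ?f \<alpha> x - (\<Sum>k\<in>F. c k * fourier_basis Y k x)) < ?\<epsilon>"
      using trig_dense[OF sq] \<epsilon>' unfolding trig_approximable_def is_trig_def by blast
    moreover have "0 \<le> (\<Sum>k\<in>F. (norm (c k - coeff (?f \<alpha>) k))\<^sup>2)" by (simp add: sum_nonneg)
    ultimately show ?thesis using energy_diff_trig[OF sq F(1), of c] by (intro exI[of _ F]) linarith
  qed
  then obtain F where F: "\<And>\<alpha>. finite (F \<alpha>)"
    "\<And>\<alpha>. energy (?f \<alpha>) - (\<Sum>k\<in>F \<alpha>. (norm (coeff (?f \<alpha>) k))\<^sup>2) < ?\<epsilon>" by metis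
  let ?G = "\<Union>\<alpha>. F \<alpha>"
  have fin: "finite ?G" using F by simp
  have "energy (?f \<alpha>) - (\<Sum>k\<in>?G. (norm (coeff (?f \<alpha>) k))\<^sup>2) < ?\<epsilon>" for \<alpha>
    using F(2)[of \<alpha>] sum_mono2[OF fin, of "F \<alpha>" "\<lambda>k. (norm (coeff (?f \<alpha>) k))\<^sup>2"] by fastforce
  then have "defect ?G u < (\<Sum>\<alpha>\<in>(UNIV::'n set). ?\<epsilon>)"
    unfolding defect_components[OF u] by (intro sum_strict_mono) auto
  then show ?thesis using that[OF fin] by simp
qed

text \<open>Componentwise, \<open>grad_trig F a\<close> is the real part of the truncated Fourier
  series. As \<open>u\<close> is real, passing to real parts does not increase the distance, whether
  or not \<open>F\<close> is symmetric.\<close>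

lemma energy_diff_grad_trig:
  fixes a :: "int ^ 'n \<Rightarrow> complex"
  assumes u: "square_integrable M u" and F: "finite F"
    and a: "\<And>k \<alpha>. fourier_coeff Y (\<lambda>x. u x $ \<alpha>) k = a k * freq Y k $ \<alpha>"
  shows "energy (\<lambda>x. u x - grad_trig F a x) \<le> defect F u"
proof -
  let ?f = "\<lambda>\<alpha> x. complex_of_real (u x $ \<alpha>)"
  let ?p = "\<lambda>\<alpha> x. \<Sum>k\<in>F. coeff (?f \<alpha>) k * fourier_basis Y k x"
  have sq: "square_integrable M (?f \<alpha>)" for \<alpha>
    by (rule square_integrable_of_real[OF square_integrable_component[OF u]])
  have g: "grad_trig F a x $ \<alpha> = Re (?p \<alpha> x)" for x \<alpha>
    by (simp add: grad_trig_nth wave_def a fourier_coeff_eq[symmetric] algebra_simps)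
  have "(norm (u x - grad_trig F a x))\<^sup>2 \<le> (\<Sum>\<alpha>\<in>UNIV. (norm (?f \<alpha> x - ?p \<alpha> x))\<^sup>2)" for x
    unfolding norm_vec_power2
  proof (intro sum_mono power_mono)
    fix \<alpha>
    have "(u x - grad_trig F a x) $ \<alpha> = Re (?f \<alpha> x - ?p \<alpha> x)" by (simp add: g del: Re_sum)
    then show "norm ((u x - grad_trig F a x) $ \<alpha>) \<le> norm (?f \<alpha> x - ?p \<alpha> x)"
      by (metis abs_Re_le_cmod real_norm_def)
  qed simp
  moreover have int: "integrable M (\<lambda>x. (norm (?f \<alpha> x - ?p \<alpha> x))\<^sup>2)" for \<alpha>
    using square_integrable_diff[OF sq square_integrable_trig] unfolding square_integrable_def by blast
  ultimately have "energy (\<lambda>x. u x - grad_trig F a x)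
      \<le> integral\<^sup>L M (\<lambda>x. \<Sum>\<alpha>\<in>UNIV. (norm (?f \<alpha> x - ?p \<alpha> x))\<^sup>2) / cell_vol Y"
    by (intro energy_bound AE_I2 Bochner_Integration.integrable_sum)
  also have "\<dots> = (\<Sum>\<alpha>\<in>UNIV. energy (\<lambda>x. ?f \<alpha> x - ?p \<alpha> x))"
    unfolding energy_def sum_divide_distrib[symmetric] using int by (simp add: Bochner_Integration.integral_sum)
  also have "\<dots> = defect F u"
    unfolding defect_components[OF u] using energy_diff_trig[OF sq F] by simp
  finally show ?thesis .
qed

lemma eventually_grid_at_top:
  "eventually (\<lambda>N. odd_grid N \<and> (\<forall>\<alpha>. n \<le> N $ \<alpha>)) (grid_at_top :: (nat ^ 'n) filter)"
proof -
  have "eventually (\<lambda>N. n \<le> Min (range (\<lambda>\<alpha>. N $ \<alpha>))) (filtercomap (\<lambda>N::nat ^ 'n. Min (range (\<lambda>\<alpha>. N $ \<alpha>))) at_top)"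
    by (rule eventually_filtercomapI) (rule eventually_ge_at_top)
  then show ?thesis unfolding grid_at_top_def eventually_inf_principal
    by eventually_elim auto
qed

lemma defect_tendsto:
  assumes u: "square_integrable M u"
  shows "((\<lambda>N. defect (freq_index N) u) \<longlongrightarrow> 0) grid_at_top"
proof (rule tendstoI)
  fix \<epsilon> :: real assume "0 < \<epsilon>"
  then obtain F where F: "finite F" "defect F u < \<epsilon>" by (rule defect_small[OF u])
  \<comment> \<open>A crude bound above every \<open>2 * \<bar>k $ \<alpha>\<bar>\<close> with
    \<open>k \<in> F\<close>; \<open>Suc\<close> provides the strict inequality of
    \<open>freq_index_odd_iff\<close>. Every odd grid with entries at least \<open>n\<close>
    contains \<open>F\<close>.\<close>
  define n where "n = Suc (\<Sum>k\<in>F. \<Sum>\<alpha>\<in>UNIV. nat (2 * \<bar>k $ \<alpha>\<bar>))"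
  have n: "2 * \<bar>k $ \<alpha>\<bar> < int n" if "k \<in> F" for k \<alpha>
  proof -
    have "nat (2 * \<bar>k $ \<alpha>\<bar>) \<le> (\<Sum>\<alpha>\<in>UNIV. nat (2 * \<bar>k $ \<alpha>\<bar>))"
      by (rule member_le_sum) auto
    also have "\<dots> \<le> (\<Sum>k\<in>F. \<Sum>\<alpha>\<in>UNIV. nat (2 * \<bar>k $ \<alpha>\<bar>))"
      using member_le_sum[OF that, of "\<lambda>k. \<Sum>\<alpha>\<in>UNIV. nat (2 * \<bar>k $ \<alpha>\<bar>)"] F(1) by simp
    finally show ?thesis unfolding n_def by linarith
  qed
  show "eventually (\<lambda>N. dist (defect (freq_index N) u) 0 < \<epsilon>) grid_at_top"
    using eventually_grid_at_top[of n]
  proof eventually_elim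
    case (elim N)
    have "F \<subseteq> freq_index N"
      using n elim unfolding freq_index_odd_iff[OF conjunct1[OF elim]] subset_eq
      by (meson of_nat_mono order_less_le_trans)
    from defect_mono[OF this finite_freq_index, of u] F(2) defect_nonneg[OF u finite_freq_index, of N]
    show ?case by simp
  qed
qed

lemma mesh_size_pos: "odd_grid N \<Longrightarrow> 0 < mesh_size Y N"
  unfolding mesh_size_def
  by (subst Max_gr_iff) (auto simp: odd_grid_def intro!: divide_pos_pos Y_pos exI odd_pos)

text \<open>Some direction has \<open>N $ \<alpha> \<le> 2 * \<bar>k $ \<alpha>\<bar>\<close>, so
  that frequency component is at least \<open>N $ \<alpha> / (2 * Y $ \<alpha>)\<close>, the
  reciprocal of the mesh width there. In particular \<open>k \<noteq> 0\<close>, so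
  \<open>freq1\<close> is \<open>freq\<close>.\<close>

lemma norm_freq_ge:
  assumes N: "odd_grid N" and k: "k \<notin> freq_index N"
  shows "1 / mesh_size Y N \<le> norm (freq1 Y k)"
proof -
  obtain \<alpha> where \<alpha>: "int (N $ \<alpha>) \<le> 2 * \<bar>k $ \<alpha>\<bar>"
    using k unfolding freq_index_odd_iff[OF N] by (auto simp: not_less)
  have Npos: "0 < N $ \<alpha>" using N by (simp add: odd_grid_def odd_pos)
  then have "k \<noteq> 0" using \<alpha> by auto
  have h: "2 * Y $ \<alpha> / N $ \<alpha> \<le> mesh_size Y N" unfolding mesh_size_def by (intro Max_ge) auto
  have hp: "0 < 2 * Y $ \<alpha> / N $ \<alpha>" using Y_pos[of \<alpha>] Npos by simp
  have "1 / mesh_size Y N \<le> 1 / (2 * Y $ \<alpha> / N $ \<alpha>)" by (intro frac_le h hp) auto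
  also have "\<dots> = real (N $ \<alpha>) / 2 / Y $ \<alpha>" by simp
  also have "\<dots> \<le> \<bar>real_of_int (k $ \<alpha>)\<bar> / Y $ \<alpha>"
    using \<alpha> Y_pos[of \<alpha>] by (intro divide_right_mono) linarith+
  also have "\<dots> = \<bar>freq Y k $ \<alpha>\<bar>" using Y_pos[of \<alpha>] by (simp add: freq_def)
  also have "\<dots> \<le> norm (freq Y k)" by (rule component_le_norm_cart)
  finally show ?thesis using \<open>k \<noteq> 0\<close> by (simp add: freq1_def)
qed

text \<open>Off the grid, \<open>mesh_size Y N * norm (freq1 Y k)\<close> is at least 1, so its
  power \<open>2 * s\<close> may be inserted in each term of the tail, turning it into a Sobolev
  term.\<close>

lemma defect_sobolev:
  assumes s: "0 < s" and u: "u \<in> Hs_per Y s" and N: "odd_grid N"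
  shows "defect (freq_index N) u \<le> (mesh_size Y N powr s * Hs_norm Y s u)\<^sup>2"
proof -
  let ?h = "mesh_size Y N" and ?t = "sobolev_term Y s (fourier_coeff_vec Y u)"
  have sum: "?t summable_on UNIV" and sq: "square_integrable M u"
    using u by (auto simp: Hs_per_def L2_per_square_integrable)
  have h: "0 < ?h" by (rule mesh_size_pos[OF N])
  have tnn: "0 \<le> ?t k" for k by (simp add: sobolev_term_def)
  have term_le: "(norm (fourier_coeff_vec Y u k))\<^sup>2 \<le> ?h powr (2 * s) * ?t k" if "k \<notin> freq_index N" for k
  proof -
    have "1 \<le> ?h * norm (freq1 Y k)" using norm_freq_ge[OF N that] h by (simp add: field_simps)
    then have "1 \<le> (?h * norm (freq1 Y k)) powr (2 * s)" using s by (intro ge_one_powr_ge_zero) auto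
    also have "\<dots> = ?h powr (2 * s) * norm (freq1 Y k) powr (2 * s)" using h by (simp add: powr_mult)
    finally have "1 * (norm (fourier_coeff_vec Y u k))\<^sup>2
        \<le> ?h powr (2 * s) * norm (freq1 Y k) powr (2 * s) * (norm (fourier_coeff_vec Y u k))\<^sup>2"
      by (intro mult_right_mono) auto
    then show ?thesis by (simp add: sobolev_term_def mult.assoc)
  qed
  have Hs: "(Hs_norm Y s u)\<^sup>2 = infsum ?t UNIV"
    unfolding Hs_norm_def by (intro real_sqrt_pow2 infsum_nonneg) (use tnn in auto)
  \<comment> \<open>A finite \<open>F\<close> stands in for the whole series: its frequencies off
    the grid account for all but \<epsilon> of the defect of the grid.\<close>
  have bound: "defect (freq_index N) u \<le> ?h powr (2 * s) * infsum ?t UNIV + \<epsilon>" if \<epsilon>: "0 < \<epsilon>" for \<epsilon>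
  proof -
    obtain F where F: "finite F" "defect F u < \<epsilon>" by (rule defect_small[OF sq \<epsilon>])
    let ?R = "F - freq_index N"
    have "defect (freq_index N \<union> F) u < \<epsilon>"
      using defect_mono[of F "freq_index N \<union> F" u] F finite_freq_index[of N] by simp
    moreover have "(\<Sum>k\<in>freq_index N \<union> F. (norm (fourier_coeff_vec Y u k))\<^sup>2)
        = (\<Sum>k\<in>freq_index N. (norm (fourier_coeff_vec Y u k))\<^sup>2) + (\<Sum>k\<in>?R. (norm (fourier_coeff_vec Y u k))\<^sup>2)"
      using F(1) finite_freq_index[of N] by (subst sum.union_disjoint[symmetric]) (auto simp: Un_Diff_cancel)
    moreover have "(\<Sum>k\<in>?R. (norm (fourier_coeff_vec Y u k))\<^sup>2) \<le> (\<Sum>k\<in>?R. ?h powr (2 * s) * ?t k)"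
      by (intro sum_mono term_le) auto
    moreover have "(\<Sum>k\<in>?R. ?h powr (2 * s) * ?t k) \<le> ?h powr (2 * s) * infsum ?t UNIV"
      unfolding sum_distrib_left[symmetric]
      by (intro mult_left_mono finite_sum_le_infsum sum) (use F(1) tnn in auto)
    ultimately show ?thesis unfolding defect_def by linarith
  qed
  have "defect (freq_index N) u \<le> ?h powr (2 * s) * infsum ?t UNIV"
    by (rule field_le_epsilon) (use bound in auto)
  also have "\<dots> = (?h powr s * Hs_norm Y s u)\<^sup>2"
    using h by (simp add: power_mult_distrib Hs powr_power mult.commute)
  finally show ?thesis .
qed

end

subsection \<open>The energy form and the proof of the theorem\<close>

lemma bounded_bilinear_matrix_vector_mult:
  "bounded_bilinear ((*v) :: real ^ 'n ^ 'm \<Rightarrow> real ^ 'n \<Rightarrow> real ^ 'm)"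
  unfolding bilinear_conv_bounded_bilinear[symmetric] bilinear_def
  by (auto intro!: linearI simp: matrix_vector_mult_add_rdistrib matrix_vector_right_distrib
      scaleR_matrix_vector_assoc matrix_vector_mult_scaleR)

context periodic_cell
begin

lemma L2_norm_eq: "L2_norm Y u = sqrt (energy u)"
  by (simp add: L2_norm_def L2_inner_def energy_def LINT_cell power2_norm_eq_inner)

lemma energy_eq_0_imp_AE:
  assumes "square_integrable M u" "energy u = 0"
  shows "AE x in M. u x = 0"
proof -
  have "integral\<^sup>L M (\<lambda>x. (norm (u x))\<^sup>2) = 0" using assms(2) by (simp add: energy_def)
  then have "AE x in M. (norm (u x))\<^sup>2 = 0"
    using assms(1) by (subst (asm) integral_nonneg_eq_0_iff_AE) (auto simp: square_integrable_def)
  then show ?thesis by eventually_elim simp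
qed

lemma wave_lincomb: "wave (complex_of_real r * a + complex_of_real t * b) k x = r * wave a k x + t * wave b k x"
  by (simp add: wave_def algebra_simps)

lemma grad_trig_diff: "grad_trig F a x - grad_trig F b x = grad_trig F (\<lambda>k. a k - b k) x"
  by (simp add: grad_trig_def wave_def left_diff_distrib scaleR_diff_left sum_subtractf)

lemma EN_space_diff:
  assumes N: "odd_grid N" and "u \<in> EN_space Y N" "v \<in> EN_space Y N"
  shows "(\<lambda>x. u x - v x) \<in> EN_space Y N"
proof -
  obtain a b where "u = grad_trig (freq_index N) a" "v = grad_trig (freq_index N) b"
    using assms(2,3) unfolding EN_space_iff[OF N] by blast
  then have "(\<lambda>x. u x - v x) = grad_trig (freq_index N) (\<lambda>k. a k - b k)"
    by (simp add: grad_trig_diff)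
  then show ?thesis unfolding EN_space_iff[OF N] by blast
qed

lemma EN_space_square_integrable: "u \<in> EN_space Y N \<Longrightarrow> square_integrable M u"
  by (simp add: EN_space_def E_space_square_integrable)

text \<open>The coefficients are integrals and do not see null sets, so they all vanish, and with
  them the sum at every point. This upgrades uniqueness almost everywhere to equality of
  functions.\<close>

lemma EN_space_AE_zero:
  assumes u: "u \<in> EN_space Y N" and zero: "AE x in M. u x = 0"
  shows "u x = 0"
proof -
  let ?Z = "freq_index N :: (int ^ 'n) set"
  obtain c where c: "\<And>x. (\<chi> \<alpha>. complex_of_real (u x $ \<alpha>)) = (\<Sum>k\<in>?Z. fourier_basis Y k x *s c k)"
    using u by (auto simp: EN_space_def trig_poly_def fun_eq_iff)
  have ux: "complex_of_real (u x $ \<alpha>) = (\<Sum>k\<in>?Z. c k $ \<alpha> * fourier_basis Y k x)" for x \<alpha>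
    using arg_cong[OF c[of x], of "\<lambda>v. v $ \<alpha>"] by (simp add: mult.commute)
  have "c k $ \<alpha> = 0" if "k \<in> ?Z" for k \<alpha>
  proof -
    have "c k $ \<alpha> = coeff (\<lambda>x. complex_of_real (u x $ \<alpha>)) k"
      unfolding ux using that by (simp add: coeff_trig finite_freq_index)
    also have "integral\<^sup>L M (\<lambda>x. complex_of_real (u x $ \<alpha>) * fourier_basis Y (- k) x) = 0"
      by (rule integral_eq_zero_AE) (use zero in eventually_elim, simp)
    then have "coeff (\<lambda>x. complex_of_real (u x $ \<alpha>)) k = 0" by (simp add: coeff_def)
    finally show ?thesis .
  qed
  then have "complex_of_real (u x $ \<alpha>) = 0" for \<alpha> unfolding ux by simp
  then show ?thesis by (simp add: vec_eq_iff)
qed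

text \<open>Indexed by a frequency and a flag choosing between the cosine and the sine mode.\<close>

definition mode :: "(int ^ 'n) \<times> bool \<Rightarrow> real ^ 'n \<Rightarrow> real ^ 'n" where
  "mode i x = wave (if snd i then 1 else \<i>) (fst i) x *\<^sub>R freq Y (fst i)"

lemma square_integrable_mode: "square_integrable M (mode i)"
  unfolding mode_def[abs_def] by (intro square_integrable_continuous continuous_intros)

text \<open>A complex amplitude is a real combination of 1 and \<open>\<i>\<close>, so the modes
  span the Galerkin space over the reals. They are dependent: \<open>k\<close> and
  \<open>- k\<close> give the same modes up to sign, and \<open>k = 0\<close> gives zero.\<close>

lemma sum_mode: "(\<Sum>i\<in>F \<times> UNIV. c i *\<^sub>R mode i x) = grad_trig F (\<lambda>k. complex_of_real (c (k, True)) + \<i> * c (k, False)) x"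
proof -
  have "(\<Sum>i\<in>F \<times> UNIV. c i *\<^sub>R mode i x) = (\<Sum>k\<in>F. \<Sum>j\<in>UNIV. c (k, j) *\<^sub>R mode (k, j) x)"
    by (simp add: sum.cartesian_product split_beta)
  also have "\<dots> = grad_trig F (\<lambda>k. complex_of_real (c (k, True)) + \<i> * c (k, False)) x"
    unfolding grad_trig_def
  proof (intro sum.cong refl)
    fix k
    show "(\<Sum>j\<in>UNIV. c (k, j) *\<^sub>R mode (k, j) x)
        = wave (complex_of_real (c (k, True)) + \<i> * c (k, False)) k x *\<^sub>R freq Y k"
      using wave_lincomb[of "c (k, True)" 1 "c (k, False)" \<i> k x]
      by (simp add: UNIV_bool mode_def scaleR_add_left mult.commute add.commute)
  qed
  finally show ?thesis .
qed

lemma grad_trig_modes: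
  "grad_trig F a x = (\<Sum>i\<in>F \<times> UNIV. (if snd i then Re (a (fst i)) else Im (a (fst i))) *\<^sub>R mode i x)"
  unfolding sum_mode by (simp add: complex_eq[symmetric])

end

section \<open>The energy form of the coefficient field \<open>A\<close>\<close>

locale elliptic_cell = periodic_cell Y for Y :: "real ^ 'n" +
  fixes A :: "real ^ 'n \<Rightarrow> real ^ 'n ^ 'n" and c_A C_A :: real
  assumes A_Linf: "A \<in> Linf_per Y"
    and constants: "0 < c_A" "c_A \<le> C_A"
    and A_elliptic: "AE x in lebesgue. x \<in> cell Y \<longrightarrow>
          transpose (A x) = A x \<and>
          (\<forall>v. c_A * (norm v)\<^sup>2 \<le> (A x *v v) \<bullet> v \<and> (A x *v v) \<bullet> v \<le> C_A * (norm v)\<^sup>2)"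
begin

lemma A_elliptic_M:
  "AE x in M. transpose (A x) = A x \<and>
    (\<forall>v. c_A * (norm v)\<^sup>2 \<le> (A x *v v) \<bullet> v \<and> (A x *v v) \<bullet> v \<le> C_A * (norm v)\<^sup>2)"
  using A_elliptic by (subst AE_restrict_space_iff) auto

lemma square_integrable_A:
  assumes u: "square_integrable M u"
  shows "square_integrable M (\<lambda>x. A x *v u x)"
proof -
  interpret mv: bounded_bilinear "(*v) :: real ^ 'n ^ 'n \<Rightarrow> real ^ 'n \<Rightarrow> real ^ 'n"
    by (rule bounded_bilinear_matrix_vector_mult)
  obtain K where K: "0 \<le> K" "\<And>a b. norm (a *v b :: real ^ 'n) \<le> norm (a :: real ^ 'n ^ 'n) * norm b * K"
    using mv.nonneg_bounded by blast
  have "compact (cell Y)" by (simp add: cell_def)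
  then obtain B where "AE x in lebesgue. x \<in> cell Y \<longrightarrow> norm (A x) \<le> B"
    using A_Linf unfolding Linf_per_def by blast
  then have B: "AE x in M. norm (A x) \<le> B" by (subst AE_restrict_space_iff) auto
  have "A \<in> borel_measurable M" using A_Linf by (simp add: Linf_per_def measurable_M)
  moreover have "u \<in> borel_measurable M" using u by (simp add: square_integrable_def)
  ultimately have m: "(\<lambda>x. A x *v u x) \<in> borel_measurable M"
    by (rule borel_measurable_continuous_Pair) (intro mv.continuous_on continuous_intros)
  show ?thesis
  proof (rule square_integrable_bound[OF u m, of "B * K"])
    show "AE x in M. norm (A x *v u x) \<le> B * K * norm (u x)"
      using B
    proof eventually_elim
      case (elim x)
      have "norm (A x *v u x) \<le> norm (A x) * (norm (u x) * K)" using K(2)[of "A x" "u x"] by (simp add: mult.assoc)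
      also have "\<dots> \<le> B * (norm (u x) * K)" using elim K(1) by (intro mult_right_mono) auto
      finally show ?case by (simp add: mult_ac)
    qed
  qed
qed

text \<open>Without the volume factor of \<open>L2_inner\<close>, which cancels from the variational
  equation.\<close>

definition form :: "(real ^ 'n \<Rightarrow> real ^ 'n) \<Rightarrow> (real ^ 'n \<Rightarrow> real ^ 'n) \<Rightarrow> real" where
  "form u v = integral\<^sup>L M (\<lambda>x. (A x *v u x) \<bullet> v x)"

lemma form_integrable:
  assumes "square_integrable M u" "square_integrable M v"
  shows "integrable M (\<lambda>x. (A x *v u x) \<bullet> v x)"
proof (rule square_integrable_bilinear[OF bounded_bilinear_inner square_integrable_A[OF assms(1)] assms(2)])
  show "(\<lambda>x. (A x *v u x) \<bullet> v x) \<in> borel_measurable M"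
    using square_integrable_A[OF assms(1)] assms(2) unfolding square_integrable_def
    by (intro borel_measurable_inner) auto
qed

lemma form_add_left:
  assumes "square_integrable M u" "square_integrable M u'" "square_integrable M v"
  shows "form (\<lambda>x. u x + u' x) v = form u v + form u' v"
  unfolding form_def
  by (simp add: matrix_vector_right_distrib inner_add_left form_integrable assms)

lemma form_diff_left:
  assumes "square_integrable M u" "square_integrable M u'" "square_integrable M v"
  shows "form (\<lambda>x. u x - u' x) v = form u v - form u' v"
  unfolding form_def
  by (simp add: matrix_vector_mult_diff_distrib inner_diff_left form_integrable assms)

lemma form_commute:
  assumes "square_integrable M u" "square_integrable M v"
  shows "form u v = form v u"
  unfolding form_def
proof (rule integral_cong_AE)
  show "(\<lambda>x. (A x *v u x) \<bullet> v x) \<in> borel_measurable M" "(\<lambda>x. (A x *v v x) \<bullet> u x) \<in> borel_measurable M"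
    using form_integrable assms by auto
  show "AE x in M. (A x *v u x) \<bullet> v x = (A x *v v x) \<bullet> u x"
    using A_elliptic_M
  proof eventually_elim
    case (elim x)
    then show ?case
      using dot_lmul_matrix[of "u x" "A x" "v x"] vector_transpose_matrix[of "u x" "A x"]
      by (simp add: inner_commute)
  qed
qed

lemma form_sum_left:
  assumes "\<And>i. i \<in> I \<Longrightarrow> square_integrable M (u i)" "square_integrable M v"
  shows "form (\<lambda>x. \<Sum>i\<in>I. c i *\<^sub>R u i x) v = (\<Sum>i\<in>I. c i * form (u i) v)"
proof -
  have "form (\<lambda>x. \<Sum>i\<in>I. c i *\<^sub>R u i x) v = integral\<^sup>L M (\<lambda>x. \<Sum>i\<in>I. c i * ((A x *v u i x) \<bullet> v x))"
    unfolding form_def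
    by (simp add: linear_sum[OF matrix_vector_mul_linear] matrix_vector_mult_scaleR inner_sum_left)
  also have "\<dots> = (\<Sum>i\<in>I. c i * form (u i) v)"
    unfolding form_def using form_integrable assms
    by (subst Bochner_Integration.integral_sum) auto
  finally show ?thesis .
qed

lemma form_sum_right:
  assumes "\<And>i. i \<in> I \<Longrightarrow> square_integrable M (v i)" "square_integrable M u"
  shows "form u (\<lambda>x. \<Sum>i\<in>I. c i *\<^sub>R v i x) = (\<Sum>i\<in>I. c i * form u (v i))"
proof -
  have "form u (\<lambda>x. \<Sum>i\<in>I. c i *\<^sub>R v i x) = integral\<^sup>L M (\<lambda>x. \<Sum>i\<in>I. c i * ((A x *v u x) \<bullet> v i x))"
    unfolding form_def by (simp add: inner_sum_right)
  also have "\<dots> = (\<Sum>i\<in>I. c i * form u (v i))"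
    unfolding form_def using form_integrable assms
    by (subst Bochner_Integration.integral_sum) auto
  finally show ?thesis .
qed

lemma form_bounds:
  assumes u: "square_integrable M u"
  shows "c_A * (cell_vol Y * energy u) \<le> form u u" "form u u \<le> C_A * (cell_vol Y * energy u)"
proof -
  have int: "integrable M (\<lambda>x. (norm (u x))\<^sup>2)" using u by (simp add: square_integrable_def)
  have e: "cell_vol Y * energy u = integral\<^sup>L M (\<lambda>x. (norm (u x))\<^sup>2)" by (simp add: energy_def)
  have "integral\<^sup>L M (\<lambda>x. c_A * (norm (u x))\<^sup>2) \<le> form u u"
    unfolding form_def
    by (intro integral_mono_AE integrable_mult_right int form_integrable u)
      (use A_elliptic_M in eventually_elim, blast)
  then show "c_A * (cell_vol Y * energy u) \<le> form u u" unfolding e by simp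
  have "form u u \<le> integral\<^sup>L M (\<lambda>x. C_A * (norm (u x))\<^sup>2)"
    unfolding form_def
    by (intro integral_mono_AE integrable_mult_right int form_integrable u)
      (use A_elliptic_M in eventually_elim, blast)
  then show "form u u \<le> C_A * (cell_vol Y * energy u)" unfolding e by simp
qed

lemma form_nonneg:
  assumes "square_integrable M u"
  shows "0 \<le> form u u"
proof -
  have "0 \<le> c_A * (cell_vol Y * energy u)"
    using constants cell_vol_pos energy_nonneg[of u] by (intro mult_nonneg_nonneg) auto
  then show ?thesis using form_bounds(1)[OF assms] by linarith
qed

lemma form_eq_0_imp_AE:
  assumes u: "square_integrable M u" and "form u u = 0"
  shows "AE x in M. u x = 0"
proof -
  have "c_A * (cell_vol Y * energy u) \<le> 0" using form_bounds(1)[OF u] assms(2) by simp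
  then have "energy u = 0"
    using constants cell_vol_pos energy_nonneg[of u] by (simp add: mult_le_0_iff zero_le_mult_iff)
  then show ?thesis by (rule energy_eq_0_imp_AE[OF u])
qed

section \<open>Existence, uniqueness and quasi-optimality of the Galerkin solution\<close>

lemma solves_on_iff:
  "solves_on Y A E V u \<longleftrightarrow> u \<in> V \<and> (\<forall>v\<in>V. form u v = - form (\<lambda>x. E) v)"
proof -
  have "L2_inner Y (\<lambda>x. A x *v w x) v = form w v / cell_vol Y" for w v
    by (simp add: L2_inner_def form_def LINT_cell)
  moreover have "p / cell_vol Y = - (q / cell_vol Y) \<longleftrightarrow> p = - q" for p q
    by (simp add: field_simps)
  ultimately show ?thesis by (simp only: solves_on_def)
qed

lemma square_integrable_const: "square_integrable M (\<lambda>x. E)" for E :: "real ^ 'n"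
  by (intro square_integrable_continuous continuous_intros)

text \<open>The Galerkin equations for the modes have their Gram matrix as system matrix. A null
  vector of it represents a field that vanishes almost everywhere, on which the right-hand side
  vanishes too; this is the consistency that the semidefinite system needs.\<close>

lemma galerkin_exists:
  assumes N: "odd_grid N"
  shows "\<exists>u. solves_on Y A E (EN_space Y N) u"
proof -
  let ?I = "freq_index N \<times> (UNIV :: bool set)"
  let ?w = "\<lambda>c x. \<Sum>i\<in>?I. c i *\<^sub>R mode i x"
  note sq = square_integrable_mode
  have sqw: "square_integrable M (?w c)" for c
    by (intro square_integrable_sum square_integrable_bounded_linear[OF bounded_linear_scaleR_right] sq)
  have quad: "(\<Sum>i\<in>?I. \<Sum>j\<in>?I. c i * c j * form (mode i) (mode j)) = form (?w c) (?w c)" for c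
    by (simp add: form_sum_left[OF sq sqw] form_sum_right[OF sq sq] sum_distrib_left mult.assoc)
  have "\<exists>c. \<forall>i\<in>?I. (\<Sum>j\<in>?I. form (mode i) (mode j) * c j) = - form (\<lambda>x. E) (mode i)"
  proof (rule semidefinite_system_solvable)
    show "finite ?I" by (intro finite_cartesian_product finite_freq_index finite)
    show "form (mode i) (mode j) = form (mode j) (mode i)" for i j by (rule form_commute[OF sq sq])
    show "0 \<le> (\<Sum>i\<in>?I. \<Sum>j\<in>?I. c i * c j * form (mode i) (mode j))" for c
      unfolding quad by (rule form_nonneg[OF sqw])
    fix c assume "(\<Sum>i\<in>?I. \<Sum>j\<in>?I. c i * c j * form (mode i) (mode j)) = 0"
    then have "AE x in M. ?w c x = 0" unfolding quad by (rule form_eq_0_imp_AE[OF sqw])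
    then have "form (\<lambda>x. E) (?w c) = 0"
      unfolding form_def by (intro integral_eq_zero_AE) (auto elim!: eventually_mono)
    then show "(\<Sum>i\<in>?I. c i * - form (\<lambda>x. E) (mode i)) = 0"
      by (simp add: form_sum_right[OF sq square_integrable_const] sum_negf)
  qed
  then obtain c where c: "\<And>i. i \<in> ?I \<Longrightarrow> (\<Sum>j\<in>?I. form (mode i) (mode j) * c j) = - form (\<lambda>x. E) (mode i)"
    by blast
  have "form (?w c) v = - form (\<lambda>x. E) v" if "v \<in> EN_space Y N" for v
  proof -
    obtain a where v: "v = grad_trig (freq_index N) a" using \<open>v \<in> _\<close> EN_space_iff[OF N] by blast
    define d where "d i = (if snd i then Re (a (fst i)) else Im (a (fst i)))" for i :: "(int ^ 'n) \<times> bool"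
    have vd: "v = ?w d" unfolding v d_def by (rule ext) (rule grad_trig_modes)
    have "form (?w c) (mode i) = - form (\<lambda>x. E) (mode i)" if "i \<in> ?I" for i
    proof -
      have "form (?w c) (mode i) = (\<Sum>j\<in>?I. form (mode i) (mode j) * c j)"
        by (simp add: form_sum_left[OF sq sq] form_commute[OF sq sq, of _ i] mult.commute)
      with c[OF that] show ?thesis by simp
    qed
    then have "(\<Sum>i\<in>?I. d i * form (?w c) (mode i)) = (\<Sum>i\<in>?I. d i * - form (\<lambda>x. E) (mode i))"
      by (intro sum.cong refl) simp
    then show ?thesis
      unfolding vd form_sum_right[OF sq sqw] form_sum_right[OF sq square_integrable_const]
      by (simp add: sum_negf)
  qed
  moreover have "?w c \<in> EN_space Y N"
    unfolding EN_space_iff[OF N] sum_mode by blast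
  ultimately show ?thesis unfolding solves_on_iff by blast
qed

lemma galerkin_unique:
  assumes N: "odd_grid N"
    and u: "solves_on Y A E (EN_space Y N) u" and v: "solves_on Y A E (EN_space Y N) v"
  shows "u = v"
proof
  fix x
  let ?w = "\<lambda>x. u x - v x"
  have EN: "u \<in> EN_space Y N" "v \<in> EN_space Y N" using u v by (auto simp: solves_on_iff)
  note sq = EN[THEN EN_space_square_integrable]
  have w: "?w \<in> EN_space Y N" by (rule EN_space_diff[OF N EN])
  have "form ?w ?w = form u ?w - form v ?w"
    by (rule form_diff_left[OF sq EN_space_square_integrable[OF w]])
  also have "\<dots> = 0" using u v w by (simp add: solves_on_iff)
  finally have "AE x in M. ?w x = 0" by (rule form_eq_0_imp_AE[OF EN_space_square_integrable[OF w]])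
  from EN_space_AE_zero[OF w this, of x] show "u x = v x" by simp
qed

text \<open>Cea's argument for a symmetric form. With \<open>q\<close> the truncated Fourier series
  of \<open>e\<close>, the error \<open>?w\<close> and the discrete field \<open>?r\<close> add up
  to \<open>e - q\<close>. Orthogonality gives Pythagoras in the form, so replacing
  \<open>eN\<close> by \<open>q\<close> cannot lower its value, and the ellipticity constants
  translate this into energies.\<close>

lemma galerkin_error:
  assumes N: "odd_grid N"
    and e: "solves_on Y A E (E_space Y) e" and eN: "solves_on Y A E (EN_space Y N) eN"
  shows "energy (\<lambda>x. e x - eN x) \<le> C_A / c_A * defect (freq_index N) e"
proof -
  let ?w = "\<lambda>x. e x - eN x"
  have eE: "e \<in> E_space Y" and eNE: "eN \<in> EN_space Y N" using e eN by (auto simp: solves_on_iff)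
  note sqe = E_space_square_integrable[OF eE] and sqN = EN_space_square_integrable[OF eNE]
  obtain a :: "int ^ 'n \<Rightarrow> complex"
    where a: "\<And>k \<alpha>. fourier_coeff Y (\<lambda>x. e x $ \<alpha>) k = a k * freq Y k $ \<alpha>"
    by (rule E_space_coeff[OF eE]) (rule that)
  define q where "q = grad_trig (freq_index N) a"
  have q: "q \<in> EN_space Y N" unfolding EN_space_iff[OF N] q_def by blast
  let ?r = "\<lambda>x. eN x - q x"
  have r: "?r \<in> EN_space Y N" by (rule EN_space_diff[OF N eNE q])
  then have rE: "?r \<in> E_space Y" by (simp add: EN_space_def)
  have sqr: "square_integrable M ?r" by (rule EN_space_square_integrable[OF r])
  have sqw: "square_integrable M ?w" by (rule square_integrable_diff[OF sqe sqN])
  \<comment> \<open>\<open>?r\<close> lies in the Galerkin space and therefore in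
    \<open>E_space Y\<close>, so it may be tested in both equations, whose right-hand sides
    cancel.\<close>
  have orth: "form ?w ?r = 0"
    using e eN r rE by (simp add: form_diff_left[OF sqe sqN sqr] solves_on_iff)
  let ?z = "\<lambda>x. ?w x + ?r x"
  have sqz: "square_integrable M ?z" by (rule square_integrable_add[OF sqw sqr])
  have "form ?z ?z = form ?w ?z + form ?r ?z" by (rule form_add_left[OF sqw sqr sqz])
  also have "form ?w ?z = form ?w ?w"
    using form_commute[OF sqw sqz] form_add_left[OF sqw sqr sqw] form_commute[OF sqr sqw] orth by simp
  also have "form ?r ?z = form ?r ?r"
    using form_commute[OF sqr sqz] form_add_left[OF sqw sqr sqr] orth by simp
  finally have "form ?w ?w \<le> form ?z ?z" using form_nonneg[OF sqr] by simp
  also have "\<dots> \<le> C_A * (cell_vol Y * energy ?z)" by (rule form_bounds(2)[OF sqz])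
  finally have "c_A * (cell_vol Y * energy ?w) \<le> C_A * (cell_vol Y * energy ?z)"
    using form_bounds(1)[OF sqw] by linarith
  then have "cell_vol Y * (c_A * energy ?w) \<le> cell_vol Y * (C_A * energy ?z)" by (simp only: mult_ac)
  then have "c_A * energy ?w \<le> C_A * energy ?z" using cell_vol_pos by simp
  then have "energy ?w \<le> C_A / c_A * energy ?z" using constants by (simp add: field_simps)
  also have "energy ?z = energy (\<lambda>x. e x - q x)" by (simp add: algebra_simps)
  also have "C_A / c_A * energy (\<lambda>x. e x - q x) \<le> C_A / c_A * defect (freq_index N) e"
    unfolding q_def using constants
    by (intro mult_left_mono energy_diff_grad_trig[OF sqe finite_freq_index a]) auto
  finally show ?thesis .
qed

end

theorem proposition6:
  fixes Y :: "real ^ 'n" and E :: "real ^ 'n"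
    and A :: "real ^ 'n \<Rightarrow> real ^ 'n ^ 'n"
    and c_A C_A :: real
    and e :: "real ^ 'n \<Rightarrow> real ^ 'n"
  assumes Y_pos: "\<And>\<alpha>. 0 < Y $ \<alpha>"
    and A_Linf: "A \<in> Linf_per Y"
    and constants: "0 < c_A" "c_A \<le> C_A"
    and A_elliptic: "AE x in lebesgue. x \<in> cell Y \<longrightarrow>
          transpose (A x) = A x \<and>
          (\<forall>v. c_A * (norm v)\<^sup>2 \<le> (A x *v v) \<bullet> v \<and> (A x *v v) \<bullet> v \<le> C_A * (norm v)\<^sup>2)"
    and e_sol: "solves_on Y A E (E_space Y) e"
  shows "(\<forall>N. odd_grid N \<longrightarrow> (\<exists>!eN. solves_on Y A E (EN_space Y N) eN)) \<and>
    (\<forall>eGa. (\<forall>N. odd_grid N \<longrightarrow> solves_on Y A E (EN_space Y N) (eGa N)) \<longrightarrow>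
      ((\<lambda>N. L2_norm Y (\<lambda>x. e x - eGa N x)) \<longlongrightarrow> 0) grid_at_top \<and>
      (\<forall>s>0. e \<in> Hs_per Y s \<longrightarrow>
        (\<forall>N. odd_grid N \<longrightarrow>
          L2_norm Y (\<lambda>x. e x - eGa N x) \<le> (C_A / c_A) * mesh_size Y N powr s * Hs_norm Y s e)))"
proof -
  interpret elliptic_cell Y A c_A C_A
    using assms by unfold_locales auto
  have sqe: "square_integrable M e"
    using e_sol by (auto simp: solves_on_iff E_space_square_integrable)
  have \<rho>: "1 \<le> C_A / c_A" using constants by simp
  have err: "L2_norm Y (\<lambda>x. e x - eGa N x) \<le> sqrt (C_A / c_A * defect (freq_index N) e)"
    if "\<forall>N. odd_grid N \<longrightarrow> solves_on Y A E (EN_space Y N) (eGa N)" "odd_grid N" for eGa N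
    unfolding L2_norm_eq using galerkin_error[OF that(2) e_sol] that by simp
  have conv: "((\<lambda>N. L2_norm Y (\<lambda>x. e x - eGa N x)) \<longlongrightarrow> 0) grid_at_top"
    if Ga: "\<forall>N. odd_grid N \<longrightarrow> solves_on Y A E (EN_space Y N) (eGa N)" for eGa
  proof (rule tendsto_sandwich[OF _ _ tendsto_const])
    show "eventually (\<lambda>N. 0 \<le> L2_norm Y (\<lambda>x. e x - eGa N x)) grid_at_top"
      by (simp add: L2_norm_eq energy_nonneg)
    show "eventually (\<lambda>N. L2_norm Y (\<lambda>x. e x - eGa N x) \<le> sqrt (C_A / c_A * defect (freq_index N) e)) grid_at_top"
      using eventually_grid_at_top[of 0] by eventually_elim (use err[OF Ga] in blast)
    have "((\<lambda>N. sqrt (C_A / c_A * defect (freq_index N) e)) \<longlongrightarrow> sqrt (C_A / c_A * 0)) grid_at_top"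
      by (intro tendsto_intros defect_tendsto[OF sqe])
    then show "((\<lambda>N. sqrt (C_A / c_A * defect (freq_index N) e)) \<longlongrightarrow> 0) grid_at_top" by simp
  qed
  have rate: "L2_norm Y (\<lambda>x. e x - eGa N x) \<le> C_A / c_A * mesh_size Y N powr s * Hs_norm Y s e"
    if Ga: "\<forall>N. odd_grid N \<longrightarrow> solves_on Y A E (EN_space Y N) (eGa N)" and s: "0 < s"
      and Hs: "e \<in> Hs_per Y s" and N: "odd_grid N" for eGa s N
  proof -
    let ?b = "mesh_size Y N powr s * Hs_norm Y s e"
    have "0 \<le> Hs_norm Y s e"
      by (simp add: Hs_norm_def infsum_nonneg sobolev_term_def)
    then have b: "0 \<le> ?b" by simp
    have "C_A / c_A * defect (freq_index N) e \<le> C_A / c_A * ?b\<^sup>2"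
      using \<rho> by (intro mult_left_mono defect_sobolev[OF s Hs N]) auto
    \<comment> \<open>The bound on the squared error carries the ellipticity ratio to the first
      power. As the ratio is at least 1, it may be squared, which after the root leaves the constant
      of the theorem.\<close>
    also have "\<dots> \<le> (C_A / c_A)\<^sup>2 * ?b\<^sup>2"
      using \<rho> self_le_power[of "C_A / c_A" 2] by (intro mult_right_mono) auto
    also have "\<dots> = (C_A / c_A * ?b)\<^sup>2" by (simp only: power_mult_distrib)
    finally have "sqrt (C_A / c_A * defect (freq_index N) e) \<le> sqrt ((C_A / c_A * ?b)\<^sup>2)"
      by (rule real_sqrt_le_mono)
    also have "\<dots> = C_A / c_A * ?b"
      unfolding real_sqrt_abs by (rule abs_of_nonneg) (intro mult_nonneg_nonneg b, use \<rho> in linarith)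
    finally show ?thesis using err[OF Ga N] by (simp add: mult.assoc)
  qed
  show ?thesis
  proof (intro conjI allI impI)
    show "\<exists>!eN. solves_on Y A E (EN_space Y N) eN" if "odd_grid N" for N
      using galerkin_exists[OF that] galerkin_unique[OF that] by (rule ex_ex1I)
  qed (use conv rate in auto)
qed

end
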